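(* Let $\mathcal{O}\subset\mathbb{R}^n$ be a convex set which is the closure of a bounded connected open subset of $\mathbb{R}^n$ with boundary of class $C^2$, such that $\mathbb{R}^n\setminus\mathcal{O}$ is connected. Let $k_0\in\mathbb{R}^n\setminus\mathcal{O}$, let $d:\overline{\mathbb{R}^n\setminus\mathcal{O}}\to[0,+\infty[$ be the (Euclidean) distance function from $k_0$ in the presence of the obstacle $\mathcal{O}$, and let $\Sigma(d)$ be its singular set. Then $\partial\mathcal{O}\cap\Sigma(d)\ne\emptyset$.
   Context: Distance function (case $A\equiv I$): let $\Gamma$ be the set of all (locally) absolutely continuous curves $\gamma:[0,+\infty[\to\overline{\mathbb{R}^n\setminus\mathcal{O}}$ with $|\dot\gamma(t)|\le 1$ for a.e. $t\ge0$. For $x\in\overline{\mathbb{R}^n\setminus\mathcal{O}}$ let $\Gamma[x]=\{\gamma\in\Gamma : \gamma(0)=x\}$, and let $\tau(\gamma)=\inf\{t\ge0 : \gamma(t)=k_0\}\in[0,+\infty]$. Then $d(x)=\inf_{\gamma\in\Gamma[x]}\tau(\gamma)$. Reachable gradients: for $x\in\overline{\mathbb{R}^n\setminus\mathcal{O}}$, $D^*d(x)$ is the set of all $p\in\mathbb{R}^n$ for which there is a sequence $x_h\in\mathbb{R}^n\setminus\mathcal{O}$ of points of differentiability of $d$ with $x_h\to x$ and $Dd(x_h)\to p$. Singular set: $\Sigma(d)=\{x\in\overline{\mathbb{R}^n\setminus\mathcal{O}}\setminus\{k_0\} : D^*d(x)\text{ has at least two elements}\}$. *)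

theory Defs
  imports "HOL-Analysis.Analysis"
begin

definition C2_function :: "('a::real_normed_vector \<Rightarrow> 'b::real_normed_vector) \<Rightarrow> bool" where
  "C2_function f \<longleftrightarrow>
    (\<exists>(f' :: 'a \<Rightarrow> 'a \<Rightarrow>\<^sub>L 'b) (f'' :: 'a \<Rightarrow> 'a \<Rightarrow>\<^sub>L ('a \<Rightarrow>\<^sub>L 'b)).
       (\<forall>x. (f has_derivative blinfun_apply (f' x)) (at x)) \<and>
       (\<forall>x. (f' has_derivative blinfun_apply (f'' x)) (at x)) \<and>
       continuous_on UNIV f'')"

text \<open>
  An open set has boundary of class \<open>C\<^sup>2\<close> if, near each of its boundary points, it is the strict
  epigraph of a \<open>C\<^sup>2\<close> function over a hyperplane. The hyperplane is the orthogonal complement of the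
  unit vector \<open>e\<close>; \<open>y - (y \<bullet> e) *\<^sub>R e\<close> is the projection of \<open>y\<close> onto it, so only the
  restriction of \<open>g\<close> to the hyperplane matters (a \<open>C\<^sup>2\<close> function on the hyperplane extends to the
  whole space by composition with the projection).
\<close>

definition C2_boundary :: "'a::euclidean_space set \<Rightarrow> bool" where
  "C2_boundary U \<longleftrightarrow>
    (\<forall>x \<in> frontier U. \<exists>r>0. \<exists>e g. norm e = 1 \<and> C2_function g \<and>
       U \<inter> ball x r = {y \<in> ball x r. g (y - (y \<bullet> e) *\<^sub>R e) < y \<bullet> e})"

definition abs_continuous_on_interval :: "real \<Rightarrow> real \<Rightarrow> (real \<Rightarrow> 'a::metric_space) \<Rightarrow> bool" where
  "abs_continuous_on_interval a b f \<longleftrightarrow>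
    (\<forall>\<epsilon>>0. \<exists>\<delta>>0. \<forall>(m::nat) l u.
       (\<forall>i<m. a \<le> l i \<and> l i \<le> u i \<and> u i \<le> b) \<and>
       disjoint_family_on (\<lambda>i. {l i<..<u i}) {..<m} \<and>
       (\<Sum>i<m. u i - l i) < \<delta> \<longrightarrow>
       (\<Sum>i<m. dist (f (u i)) (f (l i))) < \<epsilon>)"

text \<open>
  Curves are functions on all of \<open>\<real>\<close>, but only their values on \<open>[0, \<infinity>)\<close> are constrained and used.
\<close>

definition admissible_curves :: "'a::euclidean_space set \<Rightarrow> (real \<Rightarrow> 'a) set" where
  "admissible_curves \<O> =
    {\<gamma>. (\<forall>T\<ge>0. abs_continuous_on_interval 0 T \<gamma>) \<and>
         (\<forall>t\<ge>0. \<gamma> t \<in> closure (- \<O>)) \<and>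
         (AE t in lebesgue. 0 \<le> t \<longrightarrow>
            (\<exists>v. (\<gamma> has_vector_derivative v) (at t) \<and> norm v \<le> 1))}"

definition hitting_time :: "'a \<Rightarrow> (real \<Rightarrow> 'a) \<Rightarrow> ereal" where
  "hitting_time k\<^sub>0 \<gamma> = (INF t \<in> {t. 0 \<le> t \<and> \<gamma> t = k\<^sub>0}. ereal t)"

text \<open>
  The infimum is taken in the extended reals, where \<open>Inf {} = \<infinity>\<close>. Only points of
  \<open>closure (- \<O>)\<close> are relevant as arguments \<open>x\<close>. Beware that \<open>real_of_ereal \<infinity> = 0\<close>: the value is
  meaningful only if \<open>k\<^sub>0\<close> can be reached from \<open>x\<close> in finite time.
\<close>

definition obstacle_dist :: "'a::euclidean_space set \<Rightarrow> 'a \<Rightarrow> 'a \<Rightarrow> real" where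
  "obstacle_dist \<O> k\<^sub>0 x =
    real_of_ereal (INF \<gamma> \<in> {\<gamma> \<in> admissible_curves \<O>. \<gamma> 0 = x}. hitting_time k\<^sub>0 \<gamma>)"

text \<open>
  Approximating points are taken in the open exterior \<open>- \<O>\<close> of a closed obstacle, so the two-sided
  gradient \<open>GDERIV\<close> does not see the irrelevant values of the function in the interior of \<open>\<O>\<close>.
\<close>

definition reachable_gradients ::
    "'a::euclidean_space set \<Rightarrow> ('a \<Rightarrow> real) \<Rightarrow> 'a \<Rightarrow> 'a set" where
  "reachable_gradients \<O> f x =
    {p. \<exists>X G. (\<forall>h::nat. X h \<in> - \<O> \<and> GDERIV f (X h) :> G h) \<and>
              X \<longlonglongrightarrow> x \<and> G \<longlonglongrightarrow> p}"

definition singular_set :: "'a::euclidean_space set \<Rightarrow> 'a \<Rightarrow> 'a set" where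
  "singular_set \<O> k\<^sub>0 =
    {x \<in> closure (- \<O>) - {k\<^sub>0}.
       \<exists>p \<in> reachable_gradients \<O> (obstacle_dist \<O> k\<^sub>0) x.
       \<exists>q \<in> reachable_gradients \<O> (obstacle_dist \<O> k\<^sub>0) x. p \<noteq> q}"

end

theory Submission
  imports Defs
begin

text \<open>
  Let \<open>x\<close> be a point of the boundary at which the distance \<open>d\<close> from \<open>k\<^sub>0\<close> is maximal. From a point of
  the open exterior every shortest path starts with a segment in some direction \<open>- v\<close>; there \<open>d\<close> is
  semiconcave with supergradient \<open>v\<close>, and it is differentiable with gradient \<open>v\<close> along the segment.
  If \<open>x\<close> were not singular, all these \<open>v\<close> would converge to one unit vector \<open>p\<close> as the point tends to
  \<open>x\<close>, and integration along segments would make \<open>p\<close> the derivative of \<open>d\<close> at \<open>x\<close> relative to the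
  closed exterior. By maximality \<open>p\<close> vanishes on the tangent hyperplane, so \<open>p\<close> is a multiple of the
  outer normal \<open>q\<close>. If \<open>k\<^sub>0\<close> is not strictly above the tangent hyperplane, a shortest path from \<open>x\<close> can
  be chosen to leave \<open>x\<close> tangentially, and \<open>d\<close> decreases along it at unit speed although \<open>p\<close>
  vanishes there. Otherwise \<open>x\<close> sees \<open>k\<^sub>0\<close>, so \<open>k\<^sub>0 - x\<close> is a positive multiple of \<open>q\<close>; then every
  other point of the obstacle is farther from \<open>k\<^sub>0\<close> than \<open>x\<close>, and the obstacle is a single point.
\<close>

subsection \<open>Admissible curves are 1-Lipschitz\<close>

text \<open>The exceptional null set is enclosed in an open set \<open>G\<close> of small measure,
  and the interval is cut by a division fine for a suitable gauge. Pieces tagged outside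
  \<open>N\<close> are controlled by the derivative at the tag; pieces tagged in \<open>N\<close>
  lie in \<open>G\<close>, so their total length is small and absolute continuity bounds their
  contribution.\<close>

lemma norm_diff_le_if_AC:
  fixes f :: "real \<Rightarrow> 'a::euclidean_space"
  assumes ab: "a \<le> b" and AC: "abs_continuous_on_interval a b f" and neg: "negligible N"
    and der: "\<And>t. t \<in> {a..b} \<Longrightarrow> t \<notin> N \<Longrightarrow> \<exists>v. (f has_vector_derivative v) (at t) \<and> norm v \<le> 1"
  shows "norm (f b - f a) \<le> b - a"
proof (rule field_le_epsilon)
  fix e0 :: real assume "e0 > 0"
  \<comment> \<open>Pieces tagged outside \<open>N\<close> will contribute at most
    \<open>(1 + e) * (b - a)\<close> and the others less than \<open>e\<close>; these bounds add up
    to \<open>b - a + e0\<close>.\<close>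
  define e where "e = e0 / (b - a + 1)"
  have "e > 0" using \<open>e0 > 0\<close> ab by (simp add: e_def)
  have "e * (b - a + 1) = e0" using ab by (simp add: e_def)
  then have e0: "e * (b - a) + e = e0" by (simp add: algebra_simps)
  obtain \<delta> where "\<delta> > 0" and \<delta>: "\<And>(m::nat) l u.
       (\<forall>i<m. a \<le> l i \<and> l i \<le> u i \<and> u i \<le> b) \<Longrightarrow>
       disjoint_family_on (\<lambda>i. {l i<..<u i}) {..<m} \<Longrightarrow>
       (\<Sum>i<m. u i - l i) < \<delta> \<Longrightarrow> (\<Sum>i<m. dist (f (u i)) (f (l i))) < e"
    using AC \<open>e > 0\<close> unfolding abs_continuous_on_interval_def by meson
  obtain G where G: "open G" "N \<subseteq> G" "G - N \<in> lmeasurable" "emeasure lebesgue (G - N) < ennreal \<delta>"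
    using sets_lebesgue_outer_open[OF negligible_imp_sets[OF neg] \<open>\<delta> > 0\<close>] by metis
  have GN: "G = (G - N) \<union> N" using G by blast
  have Gm: "G \<in> lmeasurable"
    using fmeasurable.Un[OF G(3) negligible_imp_measurable[OF neg]] GN by metis
  have "measure lebesgue G = measure lebesgue (G - N)"
    using measure_Un_null_set[of "G - N" lebesgue N] G(3) neg GN
    by (metis fmeasurableD negligible_iff_null_sets)
  then have mG: "measure lebesgue G < \<delta>"
    using G(3,4) \<open>\<delta> > 0\<close> by (simp add: emeasure_eq_measure2 ennreal_less_iff)
  have "\<exists>r>0. (t \<in> N \<longrightarrow> ball t r \<subseteq> G) \<and>
     (t \<notin> N \<longrightarrow> t \<in> {a..b} \<longrightarrow> (\<forall>y. norm (y - t) < r \<longrightarrow> norm (f y - f t) \<le> (1 + e) * norm (y - t)))" for t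
  proof (cases "t \<in> N")
    case True
    then show ?thesis using G by (meson openE subsetD)
  next
    case False
    show ?thesis
    proof (cases "t \<in> {a..b}")
      case True
      then obtain v where v: "(f has_vector_derivative v) (at t)" "norm v \<le> 1"
        using der False by blast
      then obtain r where "r > 0" and r: "\<And>y. norm (y - t) < r \<Longrightarrow>
          norm (f y - f t - (y - t) *\<^sub>R v) \<le> e * norm (y - t)"
        unfolding has_vector_derivative_def has_derivative_at_alt using \<open>e > 0\<close> by meson
      have "norm (f y - f t) \<le> (1 + e) * norm (y - t)" if "norm (y - t) < r" for y
      proof -
        have "norm (f y - f t) \<le> norm (f y - f t - (y - t) *\<^sub>R v) + norm ((y - t) *\<^sub>R v)"
          by (metis diff_add_cancel norm_triangle_ineq)
        also have "\<dots> \<le> e * norm (y - t) + norm (y - t) * 1"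
          using r[OF that] v(2) by (intro add_mono) (auto intro: mult_left_le)
        finally show ?thesis by (simp add: algebra_simps)
      qed
      then show ?thesis using \<open>r > 0\<close> False by blast
    next
      case outside: False
      show ?thesis by (rule exI[of _ 1]) (use False outside in auto)
    qed
  qed
  then obtain r where r: "\<forall>t. r t > 0 \<and> (t \<in> N \<longrightarrow> ball t (r t) \<subseteq> G) \<and>
     (t \<notin> N \<longrightarrow> t \<in> {a..b} \<longrightarrow> (\<forall>y. norm (y - t) < r t \<longrightarrow> norm (f y - f t) \<le> (1 + e) * norm (y - t)))"
    using choice[of "\<lambda>t r. r > 0 \<and> (t \<in> N \<longrightarrow> ball t r \<subseteq> G) \<and>
     (t \<notin> N \<longrightarrow> t \<in> {a..b} \<longrightarrow> (\<forall>y. norm (y - t) < r \<longrightarrow> norm (f y - f t) \<le> (1 + e) * norm (y - t)))"]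
    by blast
  have rpos: "r t > 0" for t using r by blast
  have rN: "ball t (r t) \<subseteq> G" if "t \<in> N" for t using r that by blast
  have rn: "norm (f y - f t) \<le> (1 + e) * norm (y - t)" if "t \<notin> N" "t \<in> {a..b}" "norm (y - t) < r t" for t y
    using r that by blast
  have "gauge (\<lambda>t. ball t (r t))" using rpos by (simp add: gauge_ball_dependent)
  then obtain p where p: "p tagged_division_of {a..b}" "(\<lambda>t. ball t (r t)) fine p"
    by (rule fine_division_exists_real)
  have finp: "finite p" using p(1) by (rule tagged_division_of_finite)
  have K: "x \<in> {Inf K..Sup K} \<and> interior K = {Inf K<..<Sup K} \<and> a \<le> Inf K \<and> Inf K \<le> Sup K \<and> Sup K \<le> b \<and>
      {Inf K..Sup K} \<subseteq> ball x (r x)"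
    if xK: "(x, K) \<in> p" for x K
  proof -
    obtain u v where uv: "K = {u..v}" using tagged_division_ofD(4)[OF p(1) xK] by auto
    have "x \<in> K" "K \<subseteq> {a..b}" "K \<subseteq> ball x (r x)"
      using tagged_division_ofD(2,3)[OF p(1) xK] fineD[OF p(2) xK] by auto
    then show ?thesis unfolding uv by (simp add: interior_atLeastAtMost_real)
  qed
  define P where "P = {z \<in> p. fst z \<in> N}"
  define w where "w = (\<lambda>(x::real, K). norm (f (Sup K) - f (Inf K)))"
  have finP: "finite P" and PP: "P \<subseteq> p" using finp by (auto simp: P_def)
  have "norm (f b - f a) = norm (\<Sum>(x,K)\<in>p. f (Sup K) - f (Inf K))"
    using additive_tagged_division_1[OF ab p(1), of f] by simp
  also have "\<dots> \<le> (\<Sum>z\<in>p. w z)"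
    by (rule sum_norm_le) (auto simp: w_def split: prod.splits)
  also have "\<dots> = (\<Sum>z\<in>p - P. w z) + (\<Sum>z\<in>P. w z)"
    by (rule sum.subset_diff) (use finp PP in auto)
  finally have split: "norm (f b - f a) \<le> (\<Sum>z\<in>p - P. w z) + (\<Sum>z\<in>P. w z)" .
  have "(\<Sum>z\<in>p - P. w z) \<le> (\<Sum>z\<in>p - P. (1 + e) * (case z of (x, K) \<Rightarrow> Sup K - Inf K))"
  proof (rule sum_mono, clarify)
    fix x K assume xK: "(x, K) \<in> p" "(x, K) \<notin> P"
    note k = K[OF xK(1)]
    have xN: "x \<notin> N" using xK by (auto simp: P_def)
    have xab: "x \<in> {a..b}" using k by auto
    have "Inf K \<in> {Inf K..Sup K}" "Sup K \<in> {Inf K..Sup K}" using k by auto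
    then have "Inf K \<in> ball x (r x)" "Sup K \<in> ball x (r x)" using k by blast+
    then have "norm (Inf K - x) < r x" "norm (Sup K - x) < r x"
      by (simp_all add: dist_norm norm_minus_commute)
    from this[THEN rn[OF xN xab]] norm_triangle_ineq4[of "f (Sup K) - f x" "f (Inf K) - f x"]
    have "norm (f (Sup K) - f (Inf K)) \<le> (1 + e) * norm (Sup K - x) + (1 + e) * norm (Inf K - x)"
      by simp
    \<comment> \<open>The tag lies in the piece, so its distances to the two ends add up to the
      length.\<close>
    also have "\<dots> = (1 + e) * (Sup K - Inf K)" using k by (auto simp: algebra_simps)
    finally show "w (x, K) \<le> (1 + e) * (Sup K - Inf K)" by (simp add: w_def)
  qed
  also have "\<dots> \<le> (\<Sum>z\<in>p. (1 + e) * (case z of (x, K) \<Rightarrow> Sup K - Inf K))"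
    by (rule sum_mono2) (use finp K \<open>e > 0\<close> in fastforce)+
  also have "\<dots> = (1 + e) * (b - a)"
    using additive_tagged_division_1[OF ab p(1), of "\<lambda>x. x"] by (simp flip: sum_distrib_left)
  finally have good: "(\<Sum>z\<in>p - P. w z) \<le> (1 + e) * (b - a)" .
  have "(\<Sum>z\<in>P. w z) < e"
  proof -
    \<comment> \<open>The pieces are numbered because absolute continuity is formulated for indexed
      families of intervals.\<close>
    define m where "m = card P"
    obtain h where h: "bij_betw h {..<m} P"
      using ex_bij_betw_nat_finite[OF finP] by (auto simp: m_def lessThan_atLeast0)
    define l where "l i = Inf (snd (h i))" for i
    define u where "u i = Sup (snd (h i))" for i
    have hP: "h i \<in> P" if "i < m" for i using h that by (auto simp: bij_betw_def)
    have kk: "fst (h i) \<in> N \<and> interior (snd (h i)) = {l i<..<u i} \<and> a \<le> l i \<and> l i \<le> u i \<and> u i \<le> b \<and> {l i..u i} \<subseteq> G"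
      if "i < m" for i
    proof -
      have "(fst (h i), snd (h i)) \<in> p" and N: "fst (h i) \<in> N" using hP[OF that] by (auto simp: P_def)
      note k = K[OF this(1)]
      show ?thesis using k N rN[OF N] unfolding l_def u_def by auto
    qed
    have disj: "disjoint_family_on (\<lambda>i. {l i<..<u i}) {..<m}"
    proof (unfold disjoint_family_on_def, intro ballI impI)
      fix i j assume ij: "i \<in> {..<m}" "j \<in> {..<m}" "i \<noteq> j"
      then have "h i \<noteq> h j" using h by (auto simp: bij_betw_def inj_on_def)
      moreover have "h i \<in> p" "h j \<in> p" using hP ij PP by auto
      ultimately have "interior (snd (h i)) \<inter> interior (snd (h j)) = {}"
        using p(1) unfolding tagged_division_of by (metis prod.collapse)
      then show "{l i<..<u i} \<inter> {l j<..<u j} = {}"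
        using kk ij by simp
    qed
    have "(\<Sum>i<m. u i - l i) = (\<Sum>i<m. measure lebesgue {l i<..<u i})"
      using kk by (intro sum.cong) auto
    also have "\<dots> = measure lebesgue (\<Union>i<m. {l i<..<u i})"
      by (rule measure_finite_Union[symmetric]) (use disj kk in auto)
    also have "\<dots> \<le> measure lebesgue G"
    proof (rule measure_mono_fmeasurable[OF _ _ Gm])
      show "(\<Union>i<m. {l i<..<u i}) \<subseteq> G" using kk by fastforce
    qed auto
    finally have "(\<Sum>i<m. dist (f (u i)) (f (l i))) < e"
      using mG disj kk by (intro \<delta>) auto
    moreover have "(\<Sum>i<m. dist (f (u i)) (f (l i))) = (\<Sum>z\<in>P. w z)"
      using sum.reindex_bij_betw[OF h, of w] by (simp add: w_def l_def u_def dist_norm case_prod_beta')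
    ultimately show ?thesis by simp
  qed
  then have "norm (f b - f a) \<le> (1 + e) * (b - a) + e" using split good by linarith
  then show "norm (f b - f a) \<le> b - a + e0" using e0 by (simp add: algebra_simps)
qed

lemma AC_subinterval:
  assumes "abs_continuous_on_interval a b f" "a \<le> a'" "b' \<le> b"
  shows "abs_continuous_on_interval a' b' f"
  unfolding abs_continuous_on_interval_def
proof (intro allI impI)
  fix e :: real assume "e > 0"
  then obtain d where "d > 0" and d: "\<And>(m::nat) l u.
       (\<forall>i<m. a \<le> l i \<and> l i \<le> u i \<and> u i \<le> b) \<Longrightarrow>
       disjoint_family_on (\<lambda>i. {l i<..<u i}) {..<m} \<Longrightarrow>
       (\<Sum>i<m. u i - l i) < d \<Longrightarrow> (\<Sum>i<m. dist (f (u i)) (f (l i))) < e"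
    using assms(1) unfolding abs_continuous_on_interval_def by meson
  show "\<exists>d>0. \<forall>(m::nat) l u. (\<forall>i<m. a' \<le> l i \<and> l i \<le> u i \<and> u i \<le> b') \<and>
       disjoint_family_on (\<lambda>i. {l i<..<u i}) {..<m} \<and> (\<Sum>i<m. u i - l i) < d \<longrightarrow>
       (\<Sum>i<m. dist (f (u i)) (f (l i))) < e"
  proof (intro exI[of _ d] conjI allI impI, fact)
    fix m :: nat and l u
    assume *: "(\<forall>i<m. a' \<le> l i \<and> l i \<le> u i \<and> u i \<le> b') \<and>
       disjoint_family_on (\<lambda>i. {l i<..<u i}) {..<m} \<and> (\<Sum>i<m. u i - l i) < d"
    then have "\<forall>i<m. a \<le> l i \<and> l i \<le> u i \<and> u i \<le> b" using assms(2,3) by force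
    with * show "(\<Sum>i<m. dist (f (u i)) (f (l i))) < e" by (intro d) auto
  qed
qed

lemma admissible_derivative:
  assumes "\<gamma> \<in> admissible_curves S"
  obtains N where "negligible N"
    "\<And>t. 0 \<le> t \<Longrightarrow> t \<notin> N \<Longrightarrow> \<exists>v. (\<gamma> has_vector_derivative v) (at t) \<and> norm v \<le> 1"
proof -
  have "AE t in lebesgue. 0 \<le> t \<longrightarrow> (\<exists>v. (\<gamma> has_vector_derivative v) (at t) \<and> norm v \<le> 1)"
    using assms by (simp add: admissible_curves_def)
  then show ?thesis
    unfolding eventually_ae_filter_negligible using that by blast
qed

lemma admissible_dist_le:
  assumes "\<gamma> \<in> admissible_curves S" "0 \<le> s" "s \<le> t"
  shows "dist (\<gamma> s) (\<gamma> t) \<le> t - s"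
proof -
  obtain N where N: "negligible N"
      "\<And>t. 0 \<le> t \<Longrightarrow> t \<notin> N \<Longrightarrow> \<exists>v. (\<gamma> has_vector_derivative v) (at t) \<and> norm v \<le> 1"
    using admissible_derivative[OF assms(1)] by blast
  have "abs_continuous_on_interval 0 t \<gamma>" using assms by (simp add: admissible_curves_def)
  then have "abs_continuous_on_interval s t \<gamma>" using assms by (auto intro: AC_subinterval)
  then have "norm (\<gamma> t - \<gamma> s) \<le> t - s"
    by (rule norm_diff_le_if_AC[OF assms(3) _ N(1)]) (use N assms in auto)
  then show ?thesis by (simp add: dist_norm norm_minus_commute)
qed

lemma admissibleI:
  assumes lip: "\<And>s t. 0 \<le> s \<Longrightarrow> s \<le> t \<Longrightarrow> dist (\<gamma> s) (\<gamma> t) \<le> t - s"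
    and "\<And>t. 0 \<le> t \<Longrightarrow> \<gamma> t \<in> closure (- S)"
    and "negligible N"
    and "\<And>t. 0 \<le> t \<Longrightarrow> t \<notin> N \<Longrightarrow> \<exists>v. (\<gamma> has_vector_derivative v) (at t) \<and> norm v \<le> 1"
  shows "\<gamma> \<in> admissible_curves S"
proof -
  have "abs_continuous_on_interval 0 T \<gamma>" for T
    unfolding abs_continuous_on_interval_def
  \<comment> \<open>\<open>assumption\<close> chooses \<delta> = \<epsilon>, which suffices for a
    1-Lipschitz curve.\<close>
  proof (intro allI impI exI conjI, assumption)
    fix e :: real and m :: nat and l u
    assume *: "(\<forall>i<m. 0 \<le> l i \<and> l i \<le> u i \<and> u i \<le> T) \<and>
       disjoint_family_on (\<lambda>i. {l i<..<u i}) {..<m} \<and> (\<Sum>i<m. u i - l i) < e"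
    have "(\<Sum>i<m. dist (\<gamma> (u i)) (\<gamma> (l i))) \<le> (\<Sum>i<m. u i - l i)"
      using * by (intro sum_mono) (auto simp: dist_commute intro!: lip)
    then show "(\<Sum>i<m. dist (\<gamma> (u i)) (\<gamma> (l i))) < e" using * by linarith
  qed
  moreover have "AE t in lebesgue. 0 \<le> t \<longrightarrow> (\<exists>v. (\<gamma> has_vector_derivative v) (at t) \<and> norm v \<le> 1)"
    unfolding eventually_ae_filter_negligible using assms(3,4) by blast
  ultimately show ?thesis using assms(2) by (auto simp: admissible_curves_def)
qed

subsection \<open>Reaching the target in finite time\<close>

text \<open>\<open>T\<close> need not be the first visit to \<open>k\<close>: the infimum over all
  visiting times is the same, and it is an infimum of reals.\<close>

definition reaches :: "'a::euclidean_space set \<Rightarrow> 'a \<Rightarrow> 'a \<Rightarrow> real \<Rightarrow> bool" where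
  "reaches S k x T \<longleftrightarrow> 0 \<le> T \<and> (\<exists>\<gamma>\<in>admissible_curves S. \<gamma> 0 = x \<and> \<gamma> T = k)"

text \<open>Reachability in finite time makes the extended infimum finite, where
  \<open>real_of_ereal\<close> loses nothing.\<close>

lemma obstacle_dist_eq_Inf:
  assumes "reaches S k x T0"
  shows "obstacle_dist S k x = Inf {T. reaches S k x T}"
proof -
  have "(INF \<gamma> \<in> {\<gamma> \<in> admissible_curves S. \<gamma> 0 = x}. hitting_time k \<gamma>) = (INF T\<in>{T. reaches S k x T}. ereal T)"
    (is "?l = ?r")
  proof (rule antisym)
    show "?l \<le> ?r"
    proof (rule INF_greatest)
      fix T assume "T \<in> {T. reaches S k x T}"
      then obtain \<gamma> where "0 \<le> T" "\<gamma> \<in> admissible_curves S" "\<gamma> 0 = x" "\<gamma> T = k"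
        by (auto simp: reaches_def)
      then show "?l \<le> ereal T"
        unfolding hitting_time_def by (intro INF_lower2[of \<gamma>] INF_lower) auto
    qed
    show "?r \<le> ?l"
      unfolding hitting_time_def
      by (intro INF_greatest INF_lower) (auto simp: reaches_def)
  qed
  also have "?r = ereal (Inf {T. reaches S k x T})"
    using assms by (intro ereal_Inf'[symmetric]) (auto simp: reaches_def intro!: bdd_belowI[of _ 0])
  finally show ?thesis by (simp add: obstacle_dist_def)
qed

lemma bdd_below_reaches: "bdd_below {T. reaches S k x T}"
  by (auto simp: reaches_def intro!: bdd_belowI[of _ 0])

lemma obstacle_dist_le: "reaches S k x T \<Longrightarrow> obstacle_dist S k x \<le> T"
  using obstacle_dist_eq_Inf bdd_below_reaches by (metis cInf_lower mem_Collect_eq)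

lemma reaches_approx:
  assumes "reaches S k x T0" "e > 0"
  obtains T where "reaches S k x T" "T < obstacle_dist S k x + e"
  using cInf_lessD[of "{T. reaches S k x T}" "obstacle_dist S k x + e"] assms obstacle_dist_eq_Inf[OF assms(1)]
  by auto

section \<open>Cutting off the start of a curve and prepending a segment\<close>

lemma admissible_shift:
  assumes "\<gamma> \<in> admissible_curves S" "0 \<le> a"
  shows "(\<lambda>t. \<gamma> (t + a)) \<in> admissible_curves S"
proof -
  obtain N where N: "negligible N"
      "\<And>t. 0 \<le> t \<Longrightarrow> t \<notin> N \<Longrightarrow> \<exists>v. (\<gamma> has_vector_derivative v) (at t) \<and> norm v \<le> 1"
    using admissible_derivative[OF assms(1)] by blast
  show ?thesis
  proof (rule admissibleI)
    show "negligible ((+) (- a) ` N)" using N(1) by (rule negligible_translation)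
    show "\<exists>v. ((\<lambda>t. \<gamma> (t + a)) has_vector_derivative v) (at t) \<and> norm v \<le> 1"
      if t: "0 \<le> t" "t \<notin> (+) (- a) ` N" for t
    proof -
      have "t + a \<notin> N" using t by (auto simp: image_iff)
      then obtain v where v: "(\<gamma> has_vector_derivative v) (at (t + a))" "norm v \<le> 1"
        using N(2)[of "t + a"] t assms by auto
      have "((\<gamma> \<circ> (\<lambda>t. t + a)) has_vector_derivative (1 *\<^sub>R v)) (at t)"
        by (rule vector_diff_chain_at) (auto intro!: derivative_eq_intros v)
      then show ?thesis using v(2) by (auto simp: o_def)
    qed
  next
    fix s t :: real assume "0 \<le> s" "s \<le> t"
    then show "dist (\<gamma> (s + a)) (\<gamma> (t + a)) \<le> t - s"
      using admissible_dist_le[OF assms(1), of "s + a" "t + a"] assms by simp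
  next
    fix t :: real assume "0 \<le> t"
    then show "\<gamma> (t + a) \<in> closure (- S)"
      using assms by (simp add: admissible_curves_def)
  qed
qed

lemma reaches_tail:
  assumes "\<gamma> \<in> admissible_curves S" "\<gamma> T = k" "0 \<le> t" "t \<le> T"
  shows "reaches S k (\<gamma> t) (T - t)"
  unfolding reaches_def using assms admissible_shift[OF assms(1,3)]
  by (auto intro!: bexI[of _ "\<lambda>s. \<gamma> (s + t)"])

lemma reaches_refl:
  assumes "k \<in> closure (- S)"
  shows "reaches S k k 0"
proof -
  have "(\<lambda>t::real. k) \<in> admissible_curves S"
    by (rule admissibleI[of _ _ "{}"]) (use assms in \<open>auto intro: exI[of _ 0]\<close>)
  then show ?thesis by (auto simp: reaches_def)
qed

lemma reaches_segment:
  assumes "reaches S k y T" and seg: "closed_segment x y \<subseteq> closure (- S)"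
  shows "reaches S k x (norm (y - x) + T)"
proof (cases "x = y")
  case True
  then show ?thesis using assms by simp
next
  case False
  define L where "L = norm (y - x)"
  have "L > 0" using False by (simp add: L_def)
  obtain \<gamma> where "0 \<le> T" and \<gamma>: "\<gamma> \<in> admissible_curves S" "\<gamma> 0 = y" "\<gamma> T = k"
    using assms by (auto simp: reaches_def)
  obtain N where N: "negligible N"
      "\<And>t. 0 \<le> t \<Longrightarrow> t \<notin> N \<Longrightarrow> \<exists>v. (\<gamma> has_vector_derivative v) (at t) \<and> norm v \<le> 1"
    using admissible_derivative[OF \<gamma>(1)] by blast
  define w where "w = (y - x) /\<^sub>R L"
  have w: "norm w = 1" using \<open>L > 0\<close> by (simp add: w_def L_def)
  have y: "y = x + L *\<^sub>R w" using \<open>L > 0\<close> by (simp add: w_def)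
  define \<beta> where "\<beta> t = (if t \<le> L then x + t *\<^sub>R w else \<gamma> (t - L))" for t
  have "\<beta> \<in> admissible_curves S"
  proof (rule admissibleI)
    \<comment> \<open>The curve may have a corner at the junction time \<open>L\<close>, so
      \<open>L\<close> joins the exceptional set.\<close>
    show "negligible (insert L ((+) L ` N))"
      using N(1) by (simp add: negligible_translation)
    show "\<exists>v. (\<beta> has_vector_derivative v) (at t) \<and> norm v \<le> 1"
      if t: "0 \<le> t" "t \<notin> insert L ((+) L ` N)" for t
    proof (cases "t < L")
      case True
      have "((\<lambda>t. x + t *\<^sub>R w) has_vector_derivative w) (at t)"
        by (auto intro!: derivative_eq_intros)
      then have "(\<beta> has_vector_derivative w) (at t)"
        by (rule has_vector_derivative_transform_within_open[of _ _ _ "{..<L}"])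
           (use True in \<open>auto simp: \<beta>_def\<close>)
      then show ?thesis using w by auto
    next
      case False
      then have "t > L" using t by auto
      have "t - L \<notin> N" using t by (auto simp: image_iff)
      then obtain v where v: "(\<gamma> has_vector_derivative v) (at (t - L))" "norm v \<le> 1"
        using N(2)[of "t - L"] \<open>t > L\<close> by auto
      have "((\<gamma> \<circ> (\<lambda>t. t - L)) has_vector_derivative (1 *\<^sub>R v)) (at t)"
        by (rule vector_diff_chain_at) (auto intro!: derivative_eq_intros v)
      then have "(\<beta> has_vector_derivative (1 *\<^sub>R v)) (at t)"
        by (rule has_vector_derivative_transform_within_open[of _ _ _ "{L<..}"])
           (use \<open>t > L\<close> in \<open>auto simp: \<beta>_def\<close>)
      then show ?thesis using v(2) by auto
    qed
  next
    fix s t :: real assume st: "0 \<le> s" "s \<le> t"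
    have lin: "dist (x + s *\<^sub>R w) (x + t *\<^sub>R w) \<le> t - s" if "s \<le> t" for s t :: real
      using that w by (simp add: dist_norm flip: scaleR_diff_left)
    consider "t \<le> L" | "s \<le> L" "L < t" | "L < s" by linarith
    then show "dist (\<beta> s) (\<beta> t) \<le> t - s"
    proof cases
      case 1
      then show ?thesis using lin st by (simp add: \<beta>_def)
    next
      case 2
      have "dist (\<beta> s) (\<beta> t) \<le> dist (x + s *\<^sub>R w) y + dist (\<gamma> 0) (\<gamma> (t - L))"
        using 2 \<gamma>(2) by (simp add: \<beta>_def dist_triangle)
      also have "\<dots> \<le> (L - s) + (t - L - 0)"
        using lin[of s L] 2 admissible_dist_le[OF \<gamma>(1), of 0 "t - L"] y by (intro add_mono) auto
      finally show ?thesis by simp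
    next
      case 3
      then show ?thesis using admissible_dist_le[OF \<gamma>(1), of "s - L" "t - L"] st by (simp add: \<beta>_def)
    qed
  next
    fix t :: real assume t: "0 \<le> t"
    show "\<beta> t \<in> closure (- S)"
    proof (cases "t \<le> L")
      case True
      have "x + t *\<^sub>R w = (1 - t / L) *\<^sub>R x + (t / L) *\<^sub>R y"
        using \<open>L > 0\<close> by (simp add: w_def algebra_simps divide_inverse)
      then have "x + t *\<^sub>R w \<in> closed_segment x y"
        unfolding in_segment using True t \<open>L > 0\<close> by (intro exI[of _ "t / L"]) auto
      then show ?thesis using True seg by (auto simp: \<beta>_def)
    next
      case False
      then show ?thesis using \<gamma>(1) by (simp add: \<beta>_def admissible_curves_def)
    qed
  qed
  moreover have "\<beta> 0 = x" "\<beta> (L + T) = k"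
    using \<open>L > 0\<close> \<open>0 \<le> T\<close> \<gamma> y by (auto simp: \<beta>_def)
  ultimately show ?thesis using \<open>L > 0\<close> \<open>0 \<le> T\<close> by (auto simp: reaches_def L_def)
qed

subsection \<open>The distance function outside a convex obstacle\<close>

text \<open>Smoothness of the boundary is left out here; it enters later through the hypothesis
  \<open>normal\<close> of \<open>frontier_meets_singular_set\<close>. The interior point
  \<open>z0\<close> is the centre from which points of the closed exterior are pushed
  outwards.\<close>

locale convex_obstacle =
  fixes S :: "'a::euclidean_space set" and k z0 :: 'a
  assumes convex: "convex S" and compact: "compact S" and connected: "connected (- S)"
    and z0: "z0 \<in> interior S" and k: "k \<in> - S"
begin

abbreviation d :: "'a \<Rightarrow> real" where
  "d \<equiv> obstacle_dist S k"

lemma open_exterior: "open (- S)"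
  using compact compact_imp_closed by blast

lemma exterior_subset: "- S \<subseteq> closure (- S)"
  by (rule closure_subset)

text \<open>If the pushed point were in \<open>S\<close>, then \<open>c\<close> would lie strictly
  between it and the interior point \<open>z0\<close>, hence be interior to
  \<open>S\<close>.\<close>

lemma push_in_exterior:
  assumes "c \<in> closure (- S)" "t > 0"
  shows "c + t *\<^sub>R (c - z0) \<in> - S"
proof
  let ?z = "c + t *\<^sub>R (c - z0)"
  assume "?z \<in> S"
  then have "?z - (t / (1 + t)) *\<^sub>R (?z - z0) \<in> interior S"
    using assms(2) by (intro mem_interior_convex_shrink convex z0) auto
  also have "?z - z0 = (1 + t) *\<^sub>R (c - z0)"
    by (simp add: algebra_simps)
  also have "?z - (t / (1 + t)) *\<^sub>R ((1 + t) *\<^sub>R (c - z0)) = c"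
    using assms(2) by simp
  finally show False using assms(1) by (simp add: closure_complement)
qed

lemma push_segment:
  assumes "c \<in> closure (- S)" "t \<ge> 0"
  shows "closed_segment c (c + t *\<^sub>R (c - z0)) \<subseteq> closure (- S)"
proof
  fix y assume "y \<in> closed_segment c (c + t *\<^sub>R (c - z0))"
  then obtain u where u: "0 \<le> u" "y = (1 - u) *\<^sub>R c + u *\<^sub>R (c + t *\<^sub>R (c - z0))"
    by (auto simp: in_segment)
  then have y: "y = c + (u * t) *\<^sub>R (c - z0)" by (simp add: algebra_simps)
  show "y \<in> closure (- S)"
  proof (cases "u * t > 0")
    case True
    then show ?thesis using push_in_exterior[OF assms(1)] y exterior_subset by auto
  next
    case False
    then have "u * t = 0" using u assms(2) mult_nonneg_nonneg[of u t] by linarith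
    then show ?thesis using y assms by auto
  qed
qed

lemma segment_in_ball_subset:
  assumes "ball x r \<subseteq> - S" "y \<in> ball x r" "z \<in> ball x r"
  shows "closed_segment y z \<subseteq> closure (- S)"
  using assms closed_segment_subset[OF assms(2,3) convex_ball] exterior_subset by blast

lemma segment_in_cball_subset:
  assumes "cball x r \<subseteq> - S" "y \<in> cball x r" "z \<in> cball x r"
  shows "closed_segment y z \<subseteq> closure (- S)"
  using assms closed_segment_subset[OF assms(2,3) convex_cball] exterior_subset by blast

text \<open>Points of a small ball are joined by segments, so the set of points that reach
  \<open>k\<close> and the set of those that do not are both open. Connectedness leaves only the
  first, which contains \<open>k\<close>.\<close>

lemma exterior_reaches:
  assumes "x \<in> - S"
  shows "\<exists>T. reaches S k x T"
proof -
  define A where "A = {x \<in> - S. \<exists>T. reaches S k x T}"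
  define B where "B = {x \<in> - S. \<not> (\<exists>T. reaches S k x T)}"
  have ball: "\<exists>r>0. ball x r \<subseteq> - S \<and> (\<forall>y\<in>ball x r. (\<exists>T. reaches S k y T) \<longleftrightarrow> (\<exists>T. reaches S k x T))"
    if x: "x \<in> - S" for x
  proof -
    obtain r where r: "r > 0" "ball x r \<subseteq> - S" using open_exterior x by (meson openE)
    have "(\<exists>T. reaches S k y T) \<longleftrightarrow> (\<exists>T. reaches S k x T)" if y: "y \<in> ball x r" for y
    proof -
      have "closed_segment x y \<subseteq> closure (- S)" "closed_segment y x \<subseteq> closure (- S)"
        using segment_in_ball_subset[OF r(2)] y r(1) by simp_all
      then show ?thesis using reaches_segment by metis
    qed
    then show ?thesis using r by blast
  qed
  have "\<exists>r>0. ball x r \<subseteq> A" if "x \<in> A" for x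
  proof -
    have "x \<in> - S" "\<exists>T. reaches S k x T" using that by (auto simp: A_def)
    then obtain r where "r > 0" "ball x r \<subseteq> - S" "\<forall>y\<in>ball x r. \<exists>T. reaches S k y T"
      using ball by metis
    then show ?thesis unfolding A_def by (intro exI[of _ r]) auto
  qed
  moreover have "\<exists>r>0. ball x r \<subseteq> B" if "x \<in> B" for x
  proof -
    have "x \<in> - S" "\<nexists>T. reaches S k x T" using that by (auto simp: B_def)
    then obtain r where "r > 0" "ball x r \<subseteq> - S" "\<forall>y\<in>ball x r. \<nexists>T. reaches S k y T"
      using ball by metis
    then show ?thesis unfolding B_def by (intro exI[of _ r]) auto
  qed
  ultimately have "open A" "open B" by (auto simp: open_contains_ball)
  then have "A \<inter> (- S) = {} \<or> B \<inter> (- S) = {}"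
    by (rule connectedD[OF connected]) (auto simp: A_def B_def)
  moreover have "k \<in> A" using reaches_refl[of k S] k exterior_subset by (auto simp: A_def)
  ultimately have "B \<inter> (- S) = {}" using k by blast
  then show ?thesis using assms by (auto simp: B_def)
qed

lemma ex_reaches:
  assumes "x \<in> closure (- S)"
  shows "\<exists>T. reaches S k x T"
  using exterior_reaches[OF push_in_exterior[OF assms zero_less_one]]
    reaches_segment[OF _ push_segment[OF assms zero_le_one]] by blast

section \<open>Comparison with Euclidean lengths and continuity up to the boundary\<close>

lemma d_le_segment:
  assumes seg: "closed_segment x y \<subseteq> closure (- S)"
  shows "d x \<le> d y + norm (y - x)"
proof (rule field_le_epsilon)
  fix e :: real assume "e > 0"
  have "y \<in> closure (- S)" using seg by auto
  then obtain T where T: "reaches S k y T" "T < d y + e"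
    using ex_reaches reaches_approx \<open>e > 0\<close> by metis
  then show "d x \<le> d y + norm (y - x) + e"
    using obstacle_dist_le[OF reaches_segment[OF T(1) seg]] by simp
qed

lemma d_lipschitz_segment:
  assumes "closed_segment x y \<subseteq> closure (- S)"
  shows "\<bar>d x - d y\<bar> \<le> norm (y - x)"
  using d_le_segment[OF assms] d_le_segment[of y x] assms
  by (simp add: closed_segment_commute norm_minus_commute abs_le_iff)

lemma norm_le_d:
  assumes "x \<in> closure (- S)"
  shows "norm (x - k) \<le> d x"
proof (rule field_le_epsilon)
  fix e :: real assume "e > 0"
  then obtain T where T: "reaches S k x T" "T < d x + e"
    using ex_reaches[OF assms] reaches_approx by metis
  then obtain \<gamma> where "\<gamma> \<in> admissible_curves S" "\<gamma> 0 = x" "\<gamma> T = k" "0 \<le> T"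
    by (auto simp: reaches_def)
  then have "norm (x - k) \<le> T"
    using admissible_dist_le[of \<gamma> S 0 T] by (simp add: dist_norm)
  then show "norm (x - k) \<le> d x + e" using T by simp
qed

text \<open>The segment between two nearby boundary points may cross the obstacle. Both are
  therefore pushed outwards, at small cost, into a ball of the open exterior, where segments are
  available.\<close>

lemma d_continuous_closure: "continuous_on (closure (- S)) d"
proof (rule continuous_onI)
  fix x and e :: real assume x: "x \<in> closure (- S)" and "e > 0"
  define R where "R = norm (x - z0) + 1"
  have "R > 0" unfolding R_def by (smt (verit) norm_ge_zero)
  \<comment> \<open>\<open>R\<close> bounds the distance to \<open>z0\<close> of points within 1 of
    \<open>x\<close>, so each push costs at most \<open>t * R = e / 4\<close>.\<close>
  define t where "t = e / (4 * R)"
  have "t > 0" using \<open>e > 0\<close> \<open>R > 0\<close> by (simp add: t_def)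
  have tR: "t * R = e / 4" using \<open>R > 0\<close> by (simp add: t_def)
  define P where "P y = y + t *\<^sub>R (y - z0)" for y
  obtain r where r: "r > 0" "ball (P x) r \<subseteq> - S"
    using push_in_exterior[OF x \<open>t > 0\<close>] open_exterior unfolding P_def by (meson openE)
  \<comment> \<open>The bound 1 keeps \<open>y\<close> in the range of \<open>R\<close>; the factor
    \<open>1 + t\<close> is the dilation of distances by \<open>P\<close>.\<close>
  define \<delta> where "\<delta> = min 1 (min r (e / 4) / (1 + t))"
  show "\<exists>\<delta>>0. \<forall>y\<in>closure (- S). dist y x < \<delta> \<longrightarrow> dist (d y) (d x) \<le> e"
  proof (intro exI[of _ \<delta>] conjI ballI impI)
    show "\<delta> > 0" using r \<open>e > 0\<close> \<open>t > 0\<close> by (simp add: \<delta>_def)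
    fix y assume y: "y \<in> closure (- S)" and yx: "dist y x < \<delta>"
    have "P x - P y = (1 + t) *\<^sub>R (x - y)" by (simp add: P_def algebra_simps)
    then have "norm (P x - P y) = (1 + t) * norm (x - y)" using \<open>t > 0\<close> by simp
    also have "\<dots> < min r (e / 4)"
    proof -
      have "norm (x - y) < min r (e / 4) / (1 + t)"
        using yx by (simp add: \<delta>_def dist_norm norm_minus_commute)
      then show ?thesis using \<open>t > 0\<close> by (simp add: pos_less_divide_eq mult.commute)
    qed
    finally have PP: "norm (P x - P y) < r" "norm (P x - P y) < e / 4" by auto
    have "closed_segment (P x) (P y) \<subseteq> closure (- S)"
      using PP r by (intro segment_in_ball_subset[OF r(2)]) (auto simp: dist_norm)
    from d_lipschitz_segment[OF this] have 1: "\<bar>d (P x) - d (P y)\<bar> \<le> e / 4"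
      using PP by (simp add: norm_minus_commute)
    have push: "\<bar>d w - d (P w)\<bar> \<le> e / 4" if "w \<in> closure (- S)" "norm (w - z0) \<le> R" for w
    proof -
      have "\<bar>d w - d (P w)\<bar> \<le> norm (P w - w)"
        unfolding P_def using push_segment[OF that(1)] \<open>t > 0\<close> by (intro d_lipschitz_segment) auto
      also have "\<dots> \<le> t * R" using that \<open>t > 0\<close> by (simp add: P_def)
      finally show ?thesis using tR by simp
    qed
    have "norm (y - x) < 1" using yx by (simp add: \<delta>_def dist_norm)
    then have "norm (y - z0) \<le> R"
      using norm_triangle_ineq[of "y - x" "x - z0"] by (simp add: R_def)
    then have "\<bar>d y - d (P y)\<bar> \<le> e / 4" by (rule push[OF y])
    moreover have "\<bar>d x - d (P x)\<bar> \<le> e / 4" by (rule push[OF x]) (simp add: R_def)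
    ultimately show "dist (d y) (d x) \<le> e" using 1 \<open>e > 0\<close> unfolding dist_real_def by linarith
  qed
qed

lemma admissible_continuous:
  assumes "\<gamma> \<in> admissible_curves A" "0 \<le> s"
  shows "continuous_on {s..T} \<gamma>"
proof (rule continuous_onI)
  fix t and e :: real assume t: "t \<in> {s..T}" and "e > 0"
  have "dist (\<gamma> t') (\<gamma> t) \<le> dist t' t" if "t' \<in> {s..T}" for t'
    using admissible_dist_le[OF assms(1), of t t'] admissible_dist_le[OF assms(1), of t' t] that t assms(2)
    by (cases "t \<le> t'") (auto simp: dist_real_def dist_commute)
  then show "\<exists>\<delta>>0. \<forall>t'\<in>{s..T}. dist t' t < \<delta> \<longrightarrow> dist (\<gamma> t') (\<gamma> t) \<le> e"
    using \<open>e > 0\<close> by (intro exI[of _ e]) force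
qed

text \<open>The curve ends at distance at least \<open>r\<close> from \<open>x\<close>, so it
  crosses the sphere; with speed at most 1 this takes at least time \<open>r\<close>.\<close>

lemma exists_on_sphere:
  assumes T: "reaches S k x T" and r: "0 < r" "r \<le> norm (x - k)"
  shows "\<exists>c\<in>closure (- S). norm (c - x) = r \<and> d c + r \<le> T"
proof -
  obtain \<gamma> where \<gamma>: "\<gamma> \<in> admissible_curves S" "\<gamma> 0 = x" "\<gamma> T = k" "0 \<le> T"
    using T by (auto simp: reaches_def)
  have "continuous_on {0..T} (\<lambda>t. norm (\<gamma> t - x))"
    by (intro continuous_intros admissible_continuous[OF \<gamma>(1)]) auto
  then obtain t where t: "0 \<le> t" "t \<le> T" "norm (\<gamma> t - x) = r"
    using IVT'[of "\<lambda>t. norm (\<gamma> t - x)" 0 r T] \<gamma> r by (auto simp: norm_minus_commute)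
  have "r \<le> t" using admissible_dist_le[OF \<gamma>(1), of 0 t] t \<gamma> by (simp add: dist_norm norm_minus_commute)
  moreover have "d (\<gamma> t) \<le> T - t"
    using reaches_tail[OF \<gamma>(1,3) t(1,2)] by (rule obstacle_dist_le)
  moreover have "\<gamma> t \<in> closure (- S)" using \<gamma>(1) t by (simp add: admissible_curves_def)
  ultimately show ?thesis using t by (intro bexI[of _ "\<gamma> t"]) auto
qed

subsection \<open>Initial directions of shortest paths\<close>

text \<open>
  \<^term>\<open>contact y r v\<close>: a shortest path from \<^term>\<open>y\<close> starts with the straight segment of length
  \<^term>\<open>r\<close> in direction \<^term>\<open>- v\<close>.
\<close>

definition contact :: "'a \<Rightarrow> real \<Rightarrow> 'a \<Rightarrow> bool" where
  "contact y r v \<longleftrightarrow> 0 < r \<and> cball y r \<subseteq> - S \<and> norm v = 1 \<and> d (y - r *\<^sub>R v) + r = d y"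

text \<open>Let \<open>c\<close> minimize \<open>d\<close> on the sphere. The radial segment gives
  \<open>d y \<le> d c + r\<close>, and almost optimal curves, which cross the sphere, give the
  converse. Compactness of the sphere thus replaces the existence of shortest paths.\<close>

lemma exists_contact:
  assumes r: "0 < r" and sub: "cball y r \<subseteq> - S" and ky: "r \<le> norm (y - k)"
  shows "\<exists>v. contact y r v"
proof -
  have cl: "cball y r \<subseteq> closure (- S)" using sub exterior_subset by blast
  have y: "y \<in> closure (- S)" using cl r by auto
  have "sphere y r \<noteq> {}" using r by simp
  moreover have "continuous_on (sphere y r) d"
    by (rule continuous_on_subset[OF d_continuous_closure]) (use cl in auto)
  ultimately obtain c where c: "c \<in> sphere y r" "\<And>z. z \<in> sphere y r \<Longrightarrow> d c \<le> d z"
    using continuous_attains_inf[OF compact_sphere] by blast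
  have "d y \<le> d c + norm (c - y)"
    using c(1) r by (intro d_le_segment segment_in_cball_subset[OF sub]) auto
  then have 1: "d y \<le> d c + r" using c(1) by (simp add: dist_norm norm_minus_commute)
  have "d c + r \<le> d y"
  proof (rule field_le_epsilon)
    fix e :: real assume "e > 0"
    then obtain T where T: "reaches S k y T" "T < d y + e"
      using ex_reaches[OF y] reaches_approx by metis
    then obtain z where "norm (z - y) = r" "d z + r \<le> T"
      using exists_on_sphere[OF T(1) r ky] by blast
    then show "d c + r \<le> d y + e"
      using c(2)[of z] T(2) by (simp add: dist_norm norm_minus_commute)
  qed
  then have "contact y r ((1 / r) *\<^sub>R (y - c))"
    using 1 sub r c(1) by (simp add: contact_def dist_norm)
  then show ?thesis ..
qed

lemma contact_upper:
  assumes con: "contact y r v" and z: "norm (z - y) \<le> r"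
  shows "d z \<le> d (y - r *\<^sub>R v) + norm (z - (y - r *\<^sub>R v))"
proof -
  have "closed_segment z (y - r *\<^sub>R v) \<subseteq> closure (- S)"
    using con z by (intro segment_in_cball_subset[of y r]) (auto simp: contact_def dist_norm norm_minus_commute)
  from d_le_segment[OF this] show ?thesis by (simp add: norm_minus_commute)
qed

text \<open>The distance to \<open>y - r *\<^sub>R v\<close>, plus a constant, lies above
  \<open>d\<close> near \<open>y\<close> and equals it at \<open>y\<close>; the bound is its second
  order expansion.\<close>

lemma contact_semiconcave:
  assumes con: "contact y r v" and z: "norm (z - y) \<le> r"
  shows "d z \<le> d y + v \<bullet> (z - y) + (norm (z - y))\<^sup>2 / (2 * r)"
proof -
  have r: "r > 0" and v: "norm v = 1" and dy: "d (y - r *\<^sub>R v) = d y - r" using con by (auto simp: contact_def)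
  define n where "n = norm (z - (y - r *\<^sub>R v))"
  have "(z - y) \<bullet> (r *\<^sub>R v) = (n\<^sup>2 - (norm (z - y))\<^sup>2 - r\<^sup>2) / 2"
    using dot_norm[of "z - y" "r *\<^sub>R v"] v by (simp add: n_def algebra_simps)
  then have n2: "n\<^sup>2 = (norm (z - y))\<^sup>2 + 2 * r * (v \<bullet> (z - y)) + r\<^sup>2"
    by (simp add: inner_commute)
  \<comment> \<open>This replaces the square root in \<open>n\<close> by its tangent line at
    \<open>r\<^sup>2\<close>.\<close>
  have "2 * r * n \<le> n\<^sup>2 + r\<^sup>2" using sum_squares_bound[of r n] by simp
  then have "2 * r * n \<le> (norm (z - y))\<^sup>2 + 2 * r * (v \<bullet> (z - y)) + 2 * r * r"
    using n2 by (simp add: power2_eq_square)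
  then have "n \<le> (norm (z - y))\<^sup>2 / (2 * r) + v \<bullet> (z - y) + r"
    using r by (simp add: field_simps)
  then show ?thesis using contact_upper[OF assms] dy by (simp add: n_def)
qed

text \<open>Near a point strictly inside the segment, \<open>d\<close> is squeezed between a cone
  with vertex \<open>y\<close> from below and a cone with vertex \<open>c\<close> from above. Both
  agree with \<open>d\<close> at that point and have gradient \<open>v\<close> there.\<close>

lemma contact_gradient:
  assumes con: "contact y r v" and s: "0 < s" "s < r"
  shows "GDERIV d (y - s *\<^sub>R v) :> v"
proof -
  have r: "r > 0" and sub: "cball y r \<subseteq> - S" and v: "norm v = 1" and dy: "d (y - r *\<^sub>R v) + r = d y"
    using con by (auto simp: contact_def)
  define m where "m = y - s *\<^sub>R v"
  define c where "c = y - r *\<^sub>R v"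
  have mc: "m - c = (r - s) *\<^sub>R v" and my: "m - y = (- s) *\<^sub>R v" by (auto simp: m_def c_def algebra_simps)
  have sg1: "sgn (m - c) = v" and sg2: "sgn (m - y) = - v"
    using s v by (auto simp: mc my sgn_scaleR sgn_div_norm)
  have lower: "d y - norm (z - y) \<le> d z" if "norm (z - y) \<le> r" for z
    using d_le_segment[OF segment_in_cball_subset[OF sub], of y z] that r
    by (auto simp: dist_norm norm_minus_commute)
  have upper: "d z \<le> d c + norm (z - c)" if "norm (z - y) \<le> r" for z
    using contact_upper[OF con that] by (simp add: c_def)
  have ny: "norm (m - y) = s" and nc: "norm (m - c) = r - s" using s v by (simp_all add: my mc)
  have dm: "d m = d y - s"
    using lower[of m] upper[of m] ny nc dy s by (simp add: c_def)
  have D1: "((\<lambda>z. d c + norm (z - c)) has_derivative (\<lambda>h. v \<bullet> h)) (at m)"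
  proof -
    have "((\<lambda>z. z - c) has_derivative (\<lambda>h. h)) (at m)" by (auto intro!: derivative_eq_intros)
    moreover have "m - c \<noteq> 0" using nc s by auto
    ultimately have "((\<lambda>z. norm (z - c)) has_derivative (\<lambda>h. h \<bullet> sgn (m - c))) (at m)"
      using has_derivative_compose[OF _ has_derivative_norm] by blast
    then show ?thesis unfolding sg1 by (auto intro!: derivative_eq_intros simp: inner_commute)
  qed
  have D2: "((\<lambda>z. d y - norm (z - y)) has_derivative (\<lambda>h. v \<bullet> h)) (at m)"
  proof -
    have "((\<lambda>z. z - y) has_derivative (\<lambda>h. h)) (at m)" by (auto intro!: derivative_eq_intros)
    moreover have "m - y \<noteq> 0" using ny s by auto
    ultimately have "((\<lambda>z. norm (z - y)) has_derivative (\<lambda>h. h \<bullet> sgn (m - y))) (at m)"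
      using has_derivative_compose[OF _ has_derivative_norm] by blast
    then show ?thesis unfolding sg2 by (auto intro!: derivative_eq_intros simp: inner_commute)
  qed
  have "(d has_derivative (\<lambda>h. v \<bullet> h)) (at m)"
    unfolding has_derivative_at_alt
  proof (intro conjI allI impI)
    show "bounded_linear (\<lambda>h. v \<bullet> h)" by (rule bounded_linear_inner_right)
    fix e :: real assume "e > 0"
    from D1 \<open>e > 0\<close> obtain d1 where d1: "d1 > 0" "\<And>z. norm (z - m) < d1 \<Longrightarrow>
        norm ((d c + norm (z - c)) - (d c + norm (m - c)) - v \<bullet> (z - m)) \<le> e * norm (z - m)"
      unfolding has_derivative_at_alt by meson
    from D2 \<open>e > 0\<close> obtain d2 where d2: "d2 > 0" "\<And>z. norm (z - m) < d2 \<Longrightarrow>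
        norm ((d y - norm (z - y)) - (d y - norm (m - y)) - v \<bullet> (z - m)) \<le> e * norm (z - m)"
      unfolding has_derivative_at_alt by meson
    show "\<exists>d0>0. \<forall>z. norm (z - m) < d0 \<longrightarrow> norm (d z - d m - v \<bullet> (z - m)) \<le> e * norm (z - m)"
    proof (intro exI[of _ "min (r - s) (min d1 d2)"] conjI allI impI)
      show "min (r - s) (min d1 d2) > 0" using s d1 d2 by auto
      fix z assume z: "norm (z - m) < min (r - s) (min d1 d2)"
      have "norm (z - y) \<le> norm (z - m) + norm (m - y)"
        using norm_triangle_ineq[of "z - m" "m - y"] by simp
      then have "norm (z - y) \<le> r" using z ny by simp
      then have "d y - norm (z - y) \<le> d z" "d z \<le> d c + norm (z - c)" using lower upper by auto
      moreover have "d c + norm (m - c) = d m" "d y - norm (m - y) = d m"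
        using dy dm ny nc by (auto simp: c_def)
      ultimately show "norm (d z - d m - v \<bullet> (z - m)) \<le> e * norm (z - m)"
        using d1(2)[of z] d2(2)[of z] z unfolding real_norm_def by linarith
    qed
  qed
  then show ?thesis by (simp add: gderiv_def m_def inner_commute)
qed

text \<open>\<open>d\<close> need not be differentiable at \<open>y n\<close> itself, so the point
  is moved a vanishing distance \<open>s n\<close> into the segment, where
  \<open>contact_gradient\<close> applies.\<close>

lemma contact_limit_gradient:
  assumes con: "\<And>n. contact (y n) (r n) (v n)" and y: "y \<longlonglongrightarrow> x" and v: "v \<longlonglongrightarrow> p"
  shows "p \<in> reachable_gradients S d x"
proof -
  define s where "s n = min (r n / 2) (inverse (real (Suc n)))" for n
  have s: "0 < s n" "s n < r n" for n using con[of n] by (auto simp: s_def contact_def)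
  define X where "X n = y n - s n *\<^sub>R v n" for n
  have "s \<longlonglongrightarrow> 0"
    using s by (intro tendsto_sandwich[OF _ _ tendsto_const LIMSEQ_inverse_real_of_nat])
       (auto simp: s_def intro!: always_eventually less_imp_le)
  then have "X \<longlonglongrightarrow> x - 0 *\<^sub>R p" unfolding X_def by (intro tendsto_intros y v)
  moreover have "X n \<in> - S" for n
  proof -
    have "X n \<in> cball (y n) (r n)"
      using s[of n] con[of n] by (simp add: X_def contact_def dist_norm)
    then show ?thesis using con[of n] by (auto simp: contact_def)
  qed
  moreover have "GDERIV d (X n) :> v n" for n
    unfolding X_def using contact_gradient[OF con s] .
  ultimately show ?thesis using v unfolding reachable_gradients_def by auto
qed

lemma contact_subsequence:
  assumes con: "\<And>n. contact (y n) (r n) (v n)" and y: "y \<longlonglongrightarrow> x"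
  obtains l \<sigma> where "strict_mono \<sigma>" "(v \<circ> \<sigma>) \<longlonglongrightarrow> l" "norm l = 1" "l \<in> reachable_gradients S d x"
proof -
  have "v n \<in> sphere 0 1" for n using con by (simp add: contact_def)
  then obtain l \<sigma> where l: "l \<in> sphere 0 1" "strict_mono \<sigma>" "(v \<circ> \<sigma>) \<longlonglongrightarrow> l"
    using compact_sphere[of "0::'a" 1] unfolding compact_def by metis
  have "l \<in> reachable_gradients S d x"
  proof (rule contact_limit_gradient)
    show "contact ((y \<circ> \<sigma>) n) ((r \<circ> \<sigma>) n) ((v \<circ> \<sigma>) n)" for n using con by simp
    show "(y \<circ> \<sigma>) \<longlonglongrightarrow> x" using y l(2) by (rule LIMSEQ_subseq_LIMSEQ)
  qed (rule l(3))
  then show ?thesis using that l by auto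
qed

text \<open>Contacts exist at exterior points arbitrarily near \<open>x\<close>, and a subsequence
  of their directions converges to some reachable gradient \<open>p\<close>. Directions staying away
  from \<open>p\<close> would accumulate at a second one.\<close>

lemma contact_directions_converge:
  assumes x: "x \<in> closure (- S)" "x \<noteq> k"
    and uniq: "\<And>p q. p \<in> reachable_gradients S d x \<Longrightarrow> q \<in> reachable_gradients S d x \<Longrightarrow> p = q"
  obtains p where "norm p = 1"
    "\<And>e. e > 0 \<Longrightarrow> \<exists>\<delta>>0. \<forall>y r v. norm (y - x) < \<delta> \<longrightarrow> contact y r v \<longrightarrow> norm (v - p) \<le> e"
proof -
  obtain y0 where y0: "\<And>n. y0 n \<in> - S" "y0 \<longlonglongrightarrow> x"
    using x(1) by (auto simp: closure_sequential)
  have "\<forall>\<^sub>F n in sequentially. y0 n \<noteq> k" using y0(2) x(2) by (rule tendsto_imp_eventually_ne)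
  then obtain N where N: "\<And>n. n \<ge> N \<Longrightarrow> y0 n \<noteq> k" by (auto simp: eventually_sequentially)
  define y where "y n = y0 (n + N)" for n
  have y: "y n \<in> - S" "y n \<noteq> k" for n using y0 N by (auto simp: y_def)
  have ylim: "y \<longlonglongrightarrow> x" unfolding y_def using y0(2) by (rule LIMSEQ_ignore_initial_segment)
  have "\<exists>r v. contact (y n) r v" for n
  proof -
    obtain r where r: "r > 0" "cball (y n) r \<subseteq> - S"
      using open_exterior y(1) by (meson open_contains_cball)
    \<comment> \<open>The radius is cut down so that \<open>k\<close> is not inside the open ball,
      as \<open>exists_contact\<close> requires.\<close>
    have "cball (y n) (min r (norm (y n - k))) \<subseteq> - S" using r by (auto simp: subset_iff)
    then show ?thesis using exists_contact[of "min r (norm (y n - k))" "y n"] r y(2)[of n] by auto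
  qed
  then obtain r v where "\<And>n. contact (y n) (r n) (v n)" by metis
  from contact_subsequence[OF this ylim] obtain p where p: "norm p = 1" "p \<in> reachable_gradients S d x"
    by metis
  have "\<exists>\<delta>>0. \<forall>y r v. norm (y - x) < \<delta> \<longrightarrow> contact y r v \<longrightarrow> norm (v - p) \<le> e" if e: "e > 0" for e
  proof (rule ccontr)
    assume no: "\<not> ?thesis"
    have "\<exists>y r v. norm (y - x) < inverse (real (Suc n)) \<and> contact y r v \<and> norm (v - p) > e" for n
    proof -
      have "inverse (real (Suc n)) > 0" by simp
      with no show ?thesis by (meson not_le)
    qed
    then obtain y r v where yrv: "\<And>n. norm (y n - x) < inverse (real (Suc n))"
        "\<And>n. contact (y n) (r n) (v n)" "\<And>n. norm (v n - p) > e" by metis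
    have "(\<lambda>n. y n - x) \<longlonglongrightarrow> 0"
      by (rule Lim_null_comparison[OF _ LIMSEQ_inverse_real_of_nat])
         (use yrv(1) in \<open>auto intro!: always_eventually less_imp_le\<close>)
    then have "y \<longlonglongrightarrow> x" by (simp add: LIM_zero_iff)
    from contact_subsequence[OF yrv(2) this] obtain l \<sigma> where
      l: "(v \<circ> \<sigma>) \<longlonglongrightarrow> l" "l \<in> reachable_gradients S d x" by metis
    have "l = p" using uniq l(2) p(2) by blast
    with l(1) have "(v \<circ> \<sigma>) \<longlonglongrightarrow> p" by (simp only:)
    then have "(\<lambda>n. norm ((v \<circ> \<sigma>) n - p)) \<longlonglongrightarrow> norm (p - p)" by (intro tendsto_intros)
    then have "norm (p - p) \<ge> e"
      by (rule LIMSEQ_le_const) (use yrv(3) in \<open>auto intro!: exI[of _ 0] less_imp_le\<close>)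
    then show False using e by simp
  qed
  then show ?thesis using that p(1) by blast
qed

section \<open>Increments along segments and differentiability at the boundary\<close>

text \<open>The segment is divided into \<open>n\<close> equal pieces. Semiconcavity bounds the
  increment over each piece by a linear term and a quadratic error; the quadratic errors sum to
  \<open>C / n\<close> and vanish in the limit.\<close>

lemma segment_estimate_upper:
  assumes seg: "closed_segment a b \<subseteq> - S" and kseg: "k \<notin> closed_segment a b"
    and dir: "\<And>y r v. y \<in> closed_segment a b \<Longrightarrow> contact y r v \<Longrightarrow> norm (v - p) \<le> e"
  shows "d b - d a \<le> p \<bullet> (b - a) + e * norm (b - a)"
proof -
  have "open (- S - {k})" using open_exterior by (intro open_Diff) auto
  moreover have "closed_segment a b \<subseteq> - S - {k}" using seg kseg by blast
  \<comment> \<open>A radius that avoids both \<open>S\<close> and \<open>k\<close> uniformly makes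
    the semiconcavity constant the same at all points of the segment.\<close>
  ultimately obtain \<rho> where \<rho>: "\<rho> > 0" "(\<Union>y\<in>closed_segment a b. cball y \<rho>) \<subseteq> - S - {k}"
    using compact_subset_open_imp_cball_epsilon_subset[OF compact_segment] by metis
  define C where "C = (norm (b - a))\<^sup>2 / (2 * \<rho>)"
  have step: "d z - d y \<le> p \<bullet> (z - y) + e * norm (z - y) + (norm (z - y))\<^sup>2 / (2 * \<rho>)"
    if y: "y \<in> closed_segment a b" and "norm (z - y) \<le> \<rho>" for y z
  proof -
    have "cball y \<rho> \<subseteq> - S - {k}" using \<rho>(2) y by blast
    then have sub: "cball y \<rho> \<subseteq> - S" "k \<notin> cball y \<rho>" by auto
    have "\<rho> \<le> norm (y - k)" using sub(2) by (simp add: dist_norm)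
    then obtain v where v: "contact y \<rho> v" using exists_contact[OF \<rho>(1) sub(1)] by blast
    have "v \<bullet> (z - y) = p \<bullet> (z - y) + (v - p) \<bullet> (z - y)" by (simp add: inner_diff_left)
    also have "(v - p) \<bullet> (z - y) \<le> norm (v - p) * norm (z - y)" by (rule norm_cauchy_schwarz)
    also have "\<dots> \<le> e * norm (z - y)" using dir[OF y v] by (rule mult_right_mono) simp
    finally show ?thesis using contact_semiconcave[OF v that(2)] by linarith
  qed
  have bound: "d b - d a \<le> p \<bullet> (b - a) + e * norm (b - a) + C * inverse (real n)"
    if n: "n > 0" "norm (b - a) / real n \<le> \<rho>" for n :: nat
  proof -
    define w where "w i = a + (real i / real n) *\<^sub>R (b - a)" for i
    have w: "w (Suc i) - w i = (1 / real n) *\<^sub>R (b - a)" for i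
      by (simp add: w_def add_divide_distrib algebra_simps)
    then have nw: "norm (w (Suc i) - w i) = norm (b - a) / real n" for i using n by simp
    have "d (w (Suc i)) - d (w i) \<le>
        (p \<bullet> (b - a) + e * norm (b - a) + C * inverse (real n)) / real n" if "i < n" for i
    proof -
      have "w i = (1 - real i / real n) *\<^sub>R a + (real i / real n) *\<^sub>R b"
        by (simp add: w_def algebra_simps)
      then have "w i \<in> closed_segment a b" using that
        unfolding in_segment by (intro exI[of _ "real i / real n"]) auto
      then have "d (w (Suc i)) - d (w i) \<le> p \<bullet> (w (Suc i) - w i) + e * norm (w (Suc i) - w i) +
          (norm (w (Suc i) - w i))\<^sup>2 / (2 * \<rho>)"
        using nw n by (intro step) auto
      also have "\<dots> = (p \<bullet> (b - a) + e * norm (b - a) + C * inverse (real n)) / real n"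
        unfolding nw unfolding w inner_scaleR_right
        using n by (simp add: C_def power2_eq_square field_simps)
      finally show ?thesis .
    qed
    then have "(\<Sum>i<n. d (w (Suc i)) - d (w i)) \<le>
        (\<Sum>i<n. (p \<bullet> (b - a) + e * norm (b - a) + C * inverse (real n)) / real n)"
      by (intro sum_mono) auto
    then show ?thesis using n sum_lessThan_telescope[of "\<lambda>i. d (w i)" n] by (simp add: w_def)
  qed
  obtain n0 :: nat where n0: "norm (b - a) / \<rho> < real n0" using reals_Archimedean2 by blast
  have "(\<lambda>n. p \<bullet> (b - a) + e * norm (b - a) + C * inverse (real n)) \<longlonglongrightarrow> p \<bullet> (b - a) + e * norm (b - a) + C * 0"
    by (intro tendsto_intros lim_inverse_n)
  moreover have "\<forall>n\<ge>Suc n0. d b - d a \<le> p \<bullet> (b - a) + e * norm (b - a) + C * inverse (real n)"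
  proof (intro allI impI bound)
    fix n assume n: "n \<ge> Suc n0"
    then show "n > 0" by simp
    have "norm (b - a) / \<rho> < real n" using n0 n by linarith
    then show "norm (b - a) / real n \<le> \<rho>" using \<rho>(1) n by (simp add: field_simps)
  qed
  ultimately show ?thesis by (metis (no_types, lifting) LIMSEQ_le_const add.right_neutral mult_zero_right)
qed

text \<open>The lower bound is the upper bound for the reversed segment.\<close>

lemma segment_estimate:
  assumes "closed_segment a b \<subseteq> - S" "k \<notin> closed_segment a b"
    and "\<And>y r v. y \<in> closed_segment a b \<Longrightarrow> contact y r v \<Longrightarrow> norm (v - p) \<le> e"
  shows "\<bar>d b - d a - p \<bullet> (b - a)\<bar> \<le> e * norm (b - a)"
proof -
  have "d b - d a \<le> p \<bullet> (b - a) + e * norm (b - a)"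
    using assms by (intro segment_estimate_upper) auto
  moreover have "d a - d b \<le> p \<bullet> (a - b) + e * norm (a - b)"
    using assms by (intro segment_estimate_upper) (auto simp: closed_segment_commute)
  ultimately show ?thesis
    by (simp add: inner_diff_right norm_minus_commute abs_le_iff)
qed

text \<open>
  The segment from \<^term>\<open>x\<close> to \<^term>\<open>c\<close> may cross the obstacle; pushing both ends away from
  \<^term>\<open>z0\<close> by a small multiple of \<^term>\<open>norm (c - x)\<close> moves it outside.
\<close>

lemma differentiable_at_boundary:
  assumes x: "x \<in> closure (- S)" "x \<noteq> k" and p: "norm p = 1"
    and dir: "\<And>e. e > 0 \<Longrightarrow> \<exists>\<delta>>0. \<forall>y r v. norm (y - x) < \<delta> \<longrightarrow> contact y r v \<longrightarrow> norm (v - p) \<le> e"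
    and q1: "\<And>z. z \<in> S \<Longrightarrow> q \<bullet> (z - x) \<le> 0" and \<kappa>: "q \<bullet> (x - z0) > 0"
    and q2: "\<And>e. e > 0 \<Longrightarrow> \<exists>\<delta>>0. \<forall>c\<in>closure (- S). norm (c - x) < \<delta> \<longrightarrow> q \<bullet> (c - x) \<ge> - (e * norm (c - x))"
    and e: "e > 0"
  shows "\<exists>\<delta>>0. \<forall>c\<in>closure (- S). norm (c - x) < \<delta> \<longrightarrow> \<bar>d c - d x - p \<bullet> (c - x)\<bar> \<le> e * norm (c - x)"
proof -
  define \<kappa> where "\<kappa> = q \<bullet> (x - z0)"
  define R where "R = norm (x - z0) + 1"
  have \<kappa>0: "\<kappa> > 0" using \<kappa> by (simp add: \<kappa>_def)
  have R1: "R \<ge> 1" by (simp add: R_def)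
  \<comment> \<open>The total error will be \<open>2 * e1 * h + 3 * l * R\<close> with
    \<open>l = 3 * e1 * h / \<kappa>\<close>, which is \<open>e * h\<close>.\<close>
  define e1 where "e1 = e / (2 + 9 * R / \<kappa>)"
  have "2 + 9 * R / \<kappa> > 0" using \<kappa>0 R1 by (simp add: add_pos_nonneg)
  then have e1: "e1 > 0" and e1e: "e1 * (2 + 9 * R / \<kappa>) = e" using e by (auto simp: e1_def)
  obtain \<delta>1 where \<delta>1: "\<delta>1 > 0" "\<And>y r v. norm (y - x) < \<delta>1 \<Longrightarrow> contact y r v \<Longrightarrow> norm (v - p) \<le> e1"
    using dir[OF e1] by blast
  obtain \<delta>2 where \<delta>2: "\<delta>2 > 0" "\<And>c. c \<in> closure (- S) \<Longrightarrow> norm (c - x) < \<delta>2 \<Longrightarrow>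
      q \<bullet> (c - x) \<ge> - (e1 * norm (c - x))"
    using q2[OF e1] by blast
  \<comment> \<open>Staying within \<open>\<delta>0\<close> of \<open>x\<close> keeps the segment in
    the range of \<open>\<delta>1\<close> and away from \<open>k\<close>.\<close>
  define \<delta>0 where "\<delta>0 = min \<delta>1 (norm (x - k))"
  have \<delta>0: "\<delta>0 > 0" using \<delta>1 x by (simp add: \<delta>0_def)
  define M where "M = 3 * e1 * R / \<kappa> + 2"
  have M: "M > 0" using e1 R1 \<kappa>0 by (simp add: M_def add_nonneg_pos)
  show ?thesis
  proof (intro exI[of _ "min (min 1 \<delta>2) (min (\<kappa> / (3 * e1)) (\<delta>0 / M))"] conjI ballI impI)
    show "0 < min (min 1 \<delta>2) (min (\<kappa> / (3 * e1)) (\<delta>0 / M))" using \<delta>2 e1 \<kappa>0 \<delta>0 M by simp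
    fix c assume c: "c \<in> closure (- S)"
      and cx: "norm (c - x) < min (min 1 \<delta>2) (min (\<kappa> / (3 * e1)) (\<delta>0 / M))"
    define h where "h = norm (c - x)"
    have h: "h < 1" "h < \<delta>2" "3 * e1 * h < \<kappa>" "M * h < \<delta>0"
      using cx e1 M by (auto simp: h_def field_simps)
    show "\<bar>d c - d x - p \<bullet> (c - x)\<bar> \<le> e * norm (c - x)"
    proof (cases "h = 0")
      case True
      then show ?thesis by (simp add: h_def)
    next
      case False
      then have h0: "h > 0" by (simp add: h_def)
      \<comment> \<open>The push gains \<open>l * \<kappa> = 3 * e1 * h\<close> in direction
        \<open>q\<close>, more than the loss of at most \<open>2 * e1 * h\<close> along the
        segment.\<close>
      define l where "l = 3 * e1 * h / \<kappa>"
      have l: "0 < l" "l < 1" "l * \<kappa> = 3 * e1 * h" using h0 h e1 \<kappa>0 by (auto simp: l_def)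
      define a where "a = x + l *\<^sub>R (x - z0)"
      define b where "b = c + l *\<^sub>R (c - z0)"
      have ab: "b - a = (1 + l) *\<^sub>R (c - x)" by (simp add: a_def b_def algebra_simps)
      then have nab: "norm (b - a) = (1 + l) * h" using l by (simp add: h_def)
      have seg: "y \<notin> S \<and> norm (y - x) < \<delta>0" if y: "y \<in> closed_segment a b" for y
      proof -
        obtain u where u: "0 \<le> u" "u \<le> 1" "y = (1 - u) *\<^sub>R a + u *\<^sub>R b"
          using y by (auto simp: in_segment)
        have "y = a + u *\<^sub>R (b - a)" using u by (simp add: algebra_simps)
        then have yx: "y - x = l *\<^sub>R (x - z0) + (u * (1 + l)) *\<^sub>R (c - x)"
          unfolding ab by (simp add: a_def)
        have ul: "0 \<le> u * (1 + l)" "u * (1 + l) \<le> 2"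
          using u l mult_mono[of u 1 "1 + l" 2] by auto
        have "q \<bullet> (c - x) \<ge> - (e1 * h)" using \<delta>2(2)[OF c] h by (simp add: h_def)
        then have "u * (1 + l) * (q \<bullet> (c - x)) \<ge> u * (1 + l) * (- (e1 * h))"
          using ul by (intro mult_left_mono) auto
        moreover have "u * (1 + l) * (e1 * h) \<le> 2 * (e1 * h)"
          using ul e1 h0 by (intro mult_right_mono) auto
        moreover have "q \<bullet> (y - x) = l * \<kappa> + u * (1 + l) * (q \<bullet> (c - x))"
          unfolding yx by (simp add: \<kappa>_def inner_add_right)
        moreover have "e1 * h > 0" using e1 h0 by simp
        ultimately have "q \<bullet> (y - x) > 0" using l(3) by (simp add: mult.assoc)
        then have "y \<notin> S" using q1[of y] by auto
        moreover have "norm (y - x) \<le> l * norm (x - z0) + u * (1 + l) * h"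
          unfolding yx h_def using l ul norm_triangle_ineq[of "l *\<^sub>R (x - z0)" "(u * (1 + l)) *\<^sub>R (c - x)"]
          by simp
        moreover have "l * norm (x - z0) \<le> l * R" using l by (simp add: R_def)
        moreover have "u * (1 + l) * h \<le> 2 * h" using ul h0 by (intro mult_right_mono) auto
        moreover have "l * R + 2 * h = M * h" by (simp add: l_def M_def field_simps)
        ultimately show ?thesis using h(4) by linarith
      qed
      have "\<bar>d b - d a - p \<bullet> (b - a)\<bar> \<le> e1 * norm (b - a)"
      proof (rule segment_estimate)
        show "closed_segment a b \<subseteq> - S" using seg by blast
        show "k \<notin> closed_segment a b" using seg by (force simp: \<delta>0_def norm_minus_commute)
        show "norm (v - p) \<le> e1" if "y \<in> closed_segment a b" "contact y r v" for y r v
          using seg[OF that(1)] \<delta>1(2)[OF _ that(2)] by (simp add: \<delta>0_def)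
      qed
      also have "e1 * norm (b - a) \<le> e1 * (2 * h)"
        unfolding nab using l e1 h0 by (intro mult_left_mono mult_right_mono) auto
      finally have 1: "\<bar>d b - d a - p \<bullet> (b - a)\<bar> \<le> e1 * (2 * h)" .
      have push: "\<bar>d w - d (w + l *\<^sub>R (w - z0))\<bar> \<le> l * R"
        if "w \<in> closure (- S)" "norm (w - x) < 1" for w
      proof -
        have "\<bar>d w - d (w + l *\<^sub>R (w - z0))\<bar> \<le> norm (w + l *\<^sub>R (w - z0) - w)"
          using push_segment[OF that(1)] l by (intro d_lipschitz_segment) auto
        also have "\<dots> = l * norm (w - z0)" using l by simp
        also have "\<dots> \<le> l * R"
          using norm_triangle_ineq[of "w - x" "x - z0"] that(2) l by (intro mult_left_mono) (auto simp: R_def)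
        finally show ?thesis .
      qed
      have 2: "\<bar>d x - d a\<bar> \<le> l * R" using push[OF x(1)] by (simp add: a_def)
      have 3: "\<bar>d c - d b\<bar> \<le> l * R" using push[OF c] h by (simp add: b_def h_def)
      have "\<bar>p \<bullet> (c - x)\<bar> \<le> h" using Cauchy_Schwarz_ineq2[of p "c - x"] p by (simp add: h_def)
      then have "\<bar>l * (p \<bullet> (c - x))\<bar> \<le> l * R"
        using l h R1 by (simp add: abs_mult)
      moreover have "p \<bullet> (b - a) = p \<bullet> (c - x) + l * (p \<bullet> (c - x))" unfolding ab by (simp add: algebra_simps)
      ultimately have "\<bar>d c - d x - p \<bullet> (c - x)\<bar> \<le> e1 * (2 * h) + 3 * (l * R)"
        using 1 2 3 by linarith
      also have "\<dots> = e1 * (2 + 9 * R / \<kappa>) * h" by (simp add: l_def field_simps)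
      finally show ?thesis using e1e by (simp add: h_def)
    qed
  qed
qed

subsection \<open>The farthest boundary point is singular\<close>

lemma half_space_interior_less:
  assumes q: "norm q = 1" "\<And>z. z \<in> S \<Longrightarrow> q \<bullet> (z - x) \<le> 0" and z: "z \<in> interior S"
  shows "q \<bullet> (z - x) < 0"
proof -
  obtain r where r: "r > 0" "cball z r \<subseteq> S" using z by (meson mem_interior_cball)
  have "z + r *\<^sub>R q \<in> S" using r q(1) by (intro subsetD[OF r(2)]) (simp add: dist_norm)
  from q(2)[OF this] have "q \<bullet> (z - x) + r \<le> 0"
    using q(1) by (simp add: inner_diff_right inner_add_right norm_eq_1)
  then show ?thesis using r(1) by simp
qed

lemma half_space_subset:
  assumes q: "norm q = 1" "\<And>z. z \<in> S \<Longrightarrow> q \<bullet> (z - x) \<le> 0" and z: "q \<bullet> (z - x) \<ge> 0"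
  shows "z \<in> closure (- S)"
  using half_space_interior_less[OF q, of z] z by (auto simp: closure_complement)

text \<open>The closed half space beyond the supporting hyperplane is convex and contains no
  interior point of the obstacle.\<close>

lemma half_space_segment:
  assumes q: "norm q = 1" "\<And>z. z \<in> S \<Longrightarrow> q \<bullet> (z - x) \<le> 0"
    and "q \<bullet> (y - x) \<ge> 0" "q \<bullet> (z - x) \<ge> 0"
  shows "closed_segment y z \<subseteq> closure (- S)"
proof -
  have "{w. q \<bullet> w \<ge> q \<bullet> x} \<subseteq> closure (- S)"
    using half_space_subset[OF q] by (auto simp: inner_diff_right)
  moreover have "closed_segment y z \<subseteq> {w. q \<bullet> w \<ge> q \<bullet> x}"
    using assms(3,4) by (intro closed_segment_subset convex_halfspace_ge) (auto simp: inner_diff_right)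
  ultimately show ?thesis by blast
qed

text \<open>
  A curve that ends in the half space of the obstacle can be replaced, up to its last visit to the
  supporting hyperplane, by a segment in that hyperplane.
\<close>

lemma exists_on_half_sphere:
  assumes q: "norm q = 1" "\<And>z. z \<in> S \<Longrightarrow> q \<bullet> (z - x) \<le> 0"
    and kq: "q \<bullet> (k - x) \<le> 0" and T: "reaches S k x T" and r: "0 < r" "r \<le> norm (x - k)"
  shows "\<exists>c\<in>closure (- S). norm (c - x) = r \<and> q \<bullet> (c - x) \<le> 0 \<and> d c + r \<le> T"
proof -
  obtain \<gamma> where \<gamma>: "\<gamma> \<in> admissible_curves S" "\<gamma> 0 = x" "\<gamma> T = k" "0 \<le> T"
    using T by (auto simp: reaches_def)
  have speed: "norm (\<gamma> t - x) \<le> t" if "0 \<le> t" for t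
    using admissible_dist_le[OF \<gamma>(1), of 0 t] that \<gamma> by (simp add: dist_norm norm_minus_commute)
  define f where "f t = q \<bullet> (\<gamma> t - x)" for t
  have cont: "continuous_on {s..T} f" if "0 \<le> s" for s
    unfolding f_def using that by (intro continuous_intros admissible_continuous[OF \<gamma>(1)]) auto
  define A where "A = {0..T} \<inter> f -` {0..}"
  have "closed A" unfolding A_def by (intro continuous_closed_preimage cont) auto
  then have "compact A" unfolding A_def by (metis compact_Icc compact_Int_closed inf.left_idem)
  moreover have "0 \<in> A" using \<gamma> by (simp add: A_def f_def)
  ultimately obtain s where s: "s \<in> A" "\<And>t. t \<in> A \<Longrightarrow> t \<le> s"
    using compact_attains_sup[of A] by blast
  have s0: "0 \<le> s" "s \<le> T" using s(1) by (auto simp: A_def)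
  \<comment> \<open>\<open>f\<close> is nonnegative at \<open>s\<close> and nonpositive at
    \<open>T\<close>, so it vanishes at some \<open>t0\<close> in between. Then \<open>t0\<close> is
    in \<open>A\<close>, hence equal to the last element \<open>s\<close>.\<close>
  obtain t0 where t0: "s \<le> t0" "t0 \<le> T" "f t0 = 0"
    using IVT2'[of f T 0 s] cont[OF s0(1)] s(1) kq \<gamma>(3) s0 by (auto simp: f_def A_def)
  then have "t0 \<in> A" using s0 by (simp add: A_def)
  then have fs: "f s = 0" using s(2) t0 by force
  show ?thesis
  proof (cases "norm (\<gamma> s - x) \<ge> r")
    case True
    define y where "y = \<gamma> s"
    define D where "D = norm (y - x)"
    have D: "D \<ge> r" "D > 0" using True r by (auto simp: D_def y_def)
    define c where "c = x + (r / D) *\<^sub>R (y - x)"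
    have cx: "c - x = (r / D) *\<^sub>R (y - x)" by (simp add: c_def)
    have "y - c = (1 - r / D) *\<^sub>R (y - x)" by (simp add: c_def algebra_simps)
    then have "norm (y - c) = (1 - r / D) * D" using D by (simp add: D_def)
    then have yc: "norm (y - c) = D - r" using D by (simp add: left_diff_distrib)
    have qy: "q \<bullet> (y - x) = 0" using fs by (simp add: f_def y_def)
    then have qc: "q \<bullet> (c - x) = 0" by (simp add: cx)
    have "d c \<le> d y + norm (y - c)"
      using qy qc by (intro d_le_segment half_space_segment[OF q]) auto
    \<comment> \<open>Reaching \<open>y\<close> took time \<open>s\<close>, which is at least
      \<open>D\<close>, so the straight replacement satisfies
      \<open>(T - s) + (D - r) + r \<le> T\<close>.\<close>
    also have "d y \<le> T - s" unfolding y_def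
      by (intro obstacle_dist_le reaches_tail \<gamma> s0)
    finally have "d c + r \<le> T" using yc speed[OF s0(1)] by (simp add: D_def y_def)
    moreover have "norm (c - x) = r" using D r by (simp add: cx flip: D_def)
    moreover have "c \<in> closure (- S)" using qc by (intro half_space_subset[OF q]) auto
    ultimately show ?thesis using qc by auto
  next
    case False
    have "continuous_on {s..T} (\<lambda>t. norm (\<gamma> t - x))"
      using s0 by (intro continuous_intros admissible_continuous[OF \<gamma>(1)]) auto
    then obtain t where t: "s \<le> t" "t \<le> T" "norm (\<gamma> t - x) = r"
      using IVT'[of "\<lambda>t. norm (\<gamma> t - x)" s r T] False \<gamma>(3) r s0 by (auto simp: norm_minus_commute)
    have "f t \<le> 0"
    proof (rule ccontr)
      assume "\<not> f t \<le> 0"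
      then have "t \<in> A" using t s0 by (auto simp: A_def)
      then have "t = s" using s(2) t(1) by force
      then show False using t(3) False by simp
    qed
    moreover have "d (\<gamma> t) \<le> T - t" using t s0 by (intro obstacle_dist_le reaches_tail \<gamma>) auto
    moreover have "\<gamma> t \<in> closure (- S)" using \<gamma>(1) t s0 by (simp add: admissible_curves_def)
    ultimately show ?thesis using t s0 speed[of t] by (intro bexI[of _ "\<gamma> t"]) (auto simp: f_def)
  qed
qed

text \<open>For a tangent vector \<tau> there are boundary points
  \<open>x + s *\<^sub>R \<tau>\<close> up to a small multiple of \<open>s\<close> in direction
  \<open>- q\<close>. Maximality and the expansion of \<open>d\<close> there give
  \<open>p \<bullet> \<tau> \<le> 0\<close>.\<close>

lemma derivative_normal_at_maximum:
  assumes q: "norm q = 1" "\<And>z. z \<in> S \<Longrightarrow> q \<bullet> (z - x) \<le> 0" and p: "norm p = 1"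
    and q2: "\<And>e. e > 0 \<Longrightarrow> \<exists>\<delta>>0. \<forall>c\<in>closure (- S). norm (c - x) < \<delta> \<longrightarrow> q \<bullet> (c - x) \<ge> - (e * norm (c - x))"
    and diff: "\<And>e. e > 0 \<Longrightarrow> \<exists>\<delta>>0. \<forall>c\<in>closure (- S). norm (c - x) < \<delta> \<longrightarrow>
      \<bar>d c - d x - p \<bullet> (c - x)\<bar> \<le> e * norm (c - x)"
    and max: "\<And>c. c \<in> frontier S \<Longrightarrow> d c \<le> d x"
  shows "p = (p \<bullet> q) *\<^sub>R q"
proof -
  have tangent: "p \<bullet> \<tau> \<le> 0" if \<tau>: "q \<bullet> \<tau> = 0" for \<tau>
  proof (rule field_le_epsilon)
    fix e0 :: real assume "e0 > 0"
    \<comment> \<open>The normal drift \<open>\<theta>\<close> will be at most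
      \<open>\<eta>\<close>, and \<open>\<epsilon>\<close> makes the expansion error at most
      \<open>\<eta> / 2\<close> per unit of \<open>s\<close>; together they stay below
      \<open>e0\<close>.\<close>
    define \<eta> where "\<eta> = min 1 (e0 / 2)"
    define K where "K = norm \<tau> + 1"
    define \<epsilon> where "\<epsilon> = \<eta> / (2 * K)"
    have \<eta>: "0 < \<eta>" "\<eta> \<le> 1" "\<eta> \<le> e0 / 2" using \<open>e0 > 0\<close> by (auto simp: \<eta>_def)
    have K: "K > 0" unfolding K_def by (smt (verit) norm_ge_zero)
    then have \<epsilon>: "\<epsilon> > 0" "\<epsilon> * K = \<eta> / 2" using \<eta> by (auto simp: \<epsilon>_def)
    obtain \<delta>2 where \<delta>2: "\<delta>2 > 0" "\<And>c. c \<in> closure (- S) \<Longrightarrow> norm (c - x) < \<delta>2 \<Longrightarrow>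
        q \<bullet> (c - x) \<ge> - (\<epsilon> * norm (c - x))"
      using q2[OF \<epsilon>(1)] by blast
    obtain \<delta>3 where \<delta>3: "\<delta>3 > 0" "\<And>c. c \<in> closure (- S) \<Longrightarrow> norm (c - x) < \<delta>3 \<Longrightarrow>
        \<bar>d c - d x - p \<bullet> (c - x)\<bar> \<le> \<epsilon> * norm (c - x)"
      using diff[OF \<epsilon>(1)] by blast
    define s where "s = min \<delta>2 \<delta>3 / (2 * K)"
    have s: "s > 0" "s * K < \<delta>2" "s * K < \<delta>3" using \<delta>2(1) \<delta>3(1) K by (auto simp: s_def)
    define c where "c \<theta> = x + s *\<^sub>R \<tau> - (\<theta> * s) *\<^sub>R q" for \<theta>
    have c: "c \<theta> - x = s *\<^sub>R \<tau> - (\<theta> * s) *\<^sub>R q" for \<theta> by (simp add: c_def)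
    have nc: "norm (c \<theta> - x) \<le> s * K" if "0 \<le> \<theta>" "\<theta> \<le> \<eta>" for \<theta>
    proof -
      have "norm (c \<theta> - x) \<le> s * norm \<tau> + \<theta> * s"
        unfolding c using norm_triangle_ineq4[of "s *\<^sub>R \<tau>" "(\<theta> * s) *\<^sub>R q"] s(1) that q(1) by simp
      also have "\<theta> * s \<le> 1 * s" using that \<eta> s(1) by (intro mult_right_mono) auto
      finally show ?thesis by (simp add: K_def algebra_simps)
    qed
    have qc: "q \<bullet> (c \<theta> - x) = - (\<theta> * s)" for \<theta>
      using q(1) \<tau> by (simp add: c inner_diff_right norm_eq_1)
    have c0: "c 0 \<notin> interior S" using half_space_interior_less[OF q, of "c 0"] qc[of 0] by auto
    \<comment> \<open>A drift of \<open>\<eta> * s\<close> below the hyperplane is twice what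
      \<open>q2\<close> allows for points of the closed exterior.\<close>
    have c\<eta>: "c \<eta> \<in> S"
    proof (rule ccontr)
      assume "c \<eta> \<notin> S"
      then have "c \<eta> \<in> closure (- S)" using exterior_subset by blast
      then have "- (\<epsilon> * norm (c \<eta> - x)) \<le> - (\<eta> * s)"
        using \<delta>2(2)[of "c \<eta>"] nc[of \<eta>] s \<eta> qc by auto
      moreover have "\<epsilon> * norm (c \<eta> - x) \<le> \<epsilon> * (s * K)"
        using nc[of \<eta>] \<eta> \<epsilon>(1) by (intro mult_left_mono) auto
      moreover have "\<epsilon> * (s * K) = \<eta> * s / 2" using \<epsilon>(2) by (simp add: algebra_simps)
      moreover have "\<eta> * s > 0" using \<eta> s by simp
      ultimately show False by linarith
    qed
    have "closed_segment (c 0) (c \<eta>) \<inter> frontier S \<noteq> {}"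
    proof (cases "c 0 \<in> S")
      case True
      then have "c 0 \<in> frontier S" using c0 closure_subset by (auto simp: frontier_def)
      then show ?thesis by auto
    next
      case False
      then show ?thesis using c\<eta> by (intro connected_Int_frontier) auto
    qed
    then obtain w where "w \<in> frontier S" "w \<in> closed_segment (c 0) (c \<eta>)" by blast
    then obtain u where w: "w \<in> frontier S" "0 \<le> u" "u \<le> 1" "w = (1 - u) *\<^sub>R c 0 + u *\<^sub>R c \<eta>"
      by (auto simp: in_segment)
    define \<theta> where "\<theta> = u * \<eta>"
    have \<theta>: "0 \<le> \<theta>" "\<theta> \<le> \<eta>" using w(2,3) \<eta> by (auto simp: \<theta>_def mult_left_le_one_le)
    have wc: "w = c \<theta>" using w(4) by (simp add: c_def \<theta>_def algebra_simps)
    have "w \<in> closure (- S)" using w(1) by (simp add: frontier_closures)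
    then have "\<bar>d w - d x - p \<bullet> (w - x)\<bar> \<le> \<epsilon> * norm (w - x)"
      using nc[OF \<theta>] s by (intro \<delta>3(2)) (auto simp: wc)
    also have "\<dots> \<le> \<epsilon> * (s * K)" using nc[OF \<theta>] \<epsilon>(1) by (intro mult_left_mono) (auto simp: wc)
    also have "\<epsilon> * (s * K) = s * (\<eta> / 2)" using \<epsilon>(2) by (simp add: algebra_simps)
    finally have "p \<bullet> (w - x) \<le> s * (\<eta> / 2)" using max[OF w(1)] by linarith
    moreover have "p \<bullet> (w - x) = s * (p \<bullet> \<tau> - \<theta> * (p \<bullet> q))"
      by (simp add: wc c inner_diff_right algebra_simps)
    ultimately have "p \<bullet> \<tau> - \<theta> * (p \<bullet> q) \<le> \<eta> / 2" using s(1) by simp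
    moreover have "\<theta> * (p \<bullet> q) \<le> \<eta> * 1"
      using \<theta> \<eta> norm_cauchy_schwarz[of p q] p q(1)
      by (metis mult.right_neutral mult_left_mono mult_right_mono order_trans zero_le_one)
    ultimately show "p \<bullet> \<tau> \<le> 0 + e0" using \<eta> by linarith
  qed
  \<comment> \<open>The tangential part of \<open>p\<close> is itself a tangent direction, and its
    squared norm is \<open>p \<bullet> \<tau>\<close>.\<close>
  define \<tau> where "\<tau> = p - (p \<bullet> q) *\<^sub>R q"
  have q\<tau>: "q \<bullet> \<tau> = 0"
    using q(1) by (simp add: \<tau>_def inner_diff_right norm_eq_1 inner_commute)
  have "\<tau> \<bullet> \<tau> = p \<bullet> \<tau> - (p \<bullet> q) * (q \<bullet> \<tau>)" by (simp add: \<tau>_def inner_diff_left)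
  then have "\<tau> \<bullet> \<tau> \<le> 0" using tangent[OF q\<tau>] q\<tau> by simp
  then have "\<tau> = 0" by (metis inner_eq_zero_iff inner_ge_zero order_antisym)
  then show ?thesis by (simp add: \<tau>_def)
qed

text \<open>The last clause of \<open>normal\<close> says that the supporting hyperplane is tangent:
  near \<open>x\<close> the closed exterior drops below it only to higher order.\<close>

lemma frontier_meets_singular_set:
  assumes normal: "\<And>x. x \<in> frontier S \<Longrightarrow> \<exists>q. norm q = 1 \<and> (\<forall>z\<in>S. q \<bullet> (z - x) \<le> 0) \<and>
      (\<forall>e>0. \<exists>\<delta>>0. \<forall>c\<in>closure (- S). norm (c - x) < \<delta> \<longrightarrow> q \<bullet> (c - x) \<ge> - (e * norm (c - x)))"
  shows "frontier S \<inter> singular_set S k \<noteq> {}"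
proof -
  have fr: "frontier S \<subseteq> closure (- S)" by (simp add: frontier_closures)
  have frS: "frontier S \<subseteq> S" using compact by (intro frontier_subset_closed compact_imp_closed)
  have "S \<noteq> {}" "S \<noteq> UNIV" using z0 k interior_subset by auto
  then have "frontier S \<noteq> {}" by (rule frontier_not_empty)
  then obtain x where x: "x \<in> frontier S" and max: "\<And>c. c \<in> frontier S \<Longrightarrow> d c \<le> d x"
    using continuous_attains_sup[OF compact_frontier[OF compact]
        _ continuous_on_subset[OF d_continuous_closure fr]] by blast
  have xc: "x \<in> closure (- S)" and xk: "x \<noteq> k" using x fr frS k by auto
  have "x \<in> singular_set S k"
  proof (rule ccontr)
    assume "x \<notin> singular_set S k"
    then have uniq: "p = q" if "p \<in> reachable_gradients S d x" "q \<in> reachable_gradients S d x" for p q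
      using xc xk that by (auto simp: singular_set_def)
    obtain p where p: "norm p = 1"
        and dir: "\<And>e. e > 0 \<Longrightarrow> \<exists>\<delta>>0. \<forall>y r v. norm (y - x) < \<delta> \<longrightarrow> contact y r v \<longrightarrow> norm (v - p) \<le> e"
      using contact_directions_converge[OF xc xk uniq] by metis
    obtain q where q: "norm q = 1" "\<And>z. z \<in> S \<Longrightarrow> q \<bullet> (z - x) \<le> 0"
      and q2: "\<And>e. e > 0 \<Longrightarrow> \<exists>\<delta>>0. \<forall>c\<in>closure (- S). norm (c - x) < \<delta> \<longrightarrow> q \<bullet> (c - x) \<ge> - (e * norm (c - x))"
      using normal[OF x] by blast
    have z0q: "q \<bullet> (z0 - x) < 0" using half_space_interior_less[OF q z0] .
    then have \<kappa>: "q \<bullet> (x - z0) > 0" by (simp add: inner_diff_right)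
    have diff: "\<exists>\<delta>>0. \<forall>c\<in>closure (- S). norm (c - x) < \<delta> \<longrightarrow> \<bar>d c - d x - p \<bullet> (c - x)\<bar> \<le> e * norm (c - x)"
      if "e > 0" for e
      using differentiable_at_boundary[OF xc xk p dir q(2) \<kappa> q2 that] .
    define l where "l = p \<bullet> q"
    have pl: "p = l *\<^sub>R q" unfolding l_def
      using derivative_normal_at_maximum[OF q p q2 diff max] .
    then have l: "\<bar>l\<bar> = 1" using p q(1) by simp
    define D where "D = norm (k - x)"
    have D: "D > 0" using xk by (simp add: D_def)
    show False
    proof (cases "q \<bullet> (k - x) \<le> 0")
      case True
      \<comment> \<open>With tolerance 1/4 the expansion gives \<open>d c \<ge> d x - r / 2\<close>,
        whereas the curve gives \<open>d c < d x - 3 * r / 4\<close>.\<close>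
      obtain \<delta>2 where \<delta>2: "\<delta>2 > 0" "\<And>c. c \<in> closure (- S) \<Longrightarrow> norm (c - x) < \<delta>2 \<Longrightarrow>
          q \<bullet> (c - x) \<ge> - (1/4 * norm (c - x))"
        using q2[of "1/4"] by auto
      obtain \<delta>3 where \<delta>3: "\<delta>3 > 0" "\<And>c. c \<in> closure (- S) \<Longrightarrow> norm (c - x) < \<delta>3 \<Longrightarrow>
          \<bar>d c - d x - p \<bullet> (c - x)\<bar> \<le> 1/4 * norm (c - x)"
        using diff[of "1/4"] by auto
      define r where "r = min (min \<delta>2 \<delta>3) D / 2"
      have r: "0 < r" "r < \<delta>2" "r < \<delta>3" "r \<le> norm (x - k)"
        using \<delta>2(1) \<delta>3(1) D unfolding norm_minus_commute[of x k] D_def[symmetric] by (auto simp: r_def)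
      obtain T where T: "reaches S k x T" "T < d x + r / 4"
        using ex_reaches[OF xc] reaches_approx[of S k x _ "r / 4"] r(1) by auto
      obtain c where c: "c \<in> closure (- S)" "norm (c - x) = r" "q \<bullet> (c - x) \<le> 0" "d c + r \<le> T"
        using exists_on_half_sphere[OF q True T(1) r(1,4)] by blast
      have "\<bar>q \<bullet> (c - x)\<bar> \<le> r / 4" using \<delta>2(2)[OF c(1)] c r by simp
      then have "\<bar>p \<bullet> (c - x)\<bar> \<le> r / 4" by (simp add: pl abs_mult l)
      moreover have "\<bar>d c - d x - p \<bullet> (c - x)\<bar> \<le> r / 4" using \<delta>3(2)[OF c(1)] c r by simp
      ultimately show False using c(4) T(2) r(1) by linarith
    next
      case False
      then have kq: "q \<bullet> (k - x) > 0" by simp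
      have dk: "d k \<le> 0" using k exterior_subset by (intro obstacle_dist_le reaches_refl) auto
      have ray: "x + s *\<^sub>R (k - x) \<in> closure (- S) \<and> d (x + s *\<^sub>R (k - x)) = (1 - s) * D"
        if s: "0 \<le> s" "s \<le> 1" for s
      proof -
        let ?c = "x + s *\<^sub>R (k - x)"
        have qc: "q \<bullet> (?c - x) \<ge> 0" using s kq by simp
        then have c: "?c \<in> closure (- S)" using half_space_subset[OF q] by blast
        have "k - ?c = (1 - s) *\<^sub>R (k - x)" by (simp add: algebra_simps)
        then have n: "norm (k - ?c) = (1 - s) * D" using s by (simp add: D_def)
        have "d ?c \<le> d k + norm (k - ?c)"
          using qc kq by (intro d_le_segment half_space_segment[OF q]) auto
        then show ?thesis using norm_le_d[OF c] dk n c by (simp add: norm_minus_commute)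
      qed
      have dx: "d x = D" using ray[of 0] by simp
      \<comment> \<open>On the segment from \<open>x\<close> to \<open>k\<close> the function
        \<open>d\<close> is the Euclidean distance to \<open>k\<close>; its slope there is compared
        with the derivative \<open>p\<close>.\<close>
      have "p \<bullet> (k - x) \<le> - D"
      proof (rule field_le_epsilon)
        fix e :: real assume "e > 0"
        then have "e / D > 0" using D by simp
        then obtain \<delta> where \<delta>: "\<delta> > 0" "\<And>c. c \<in> closure (- S) \<Longrightarrow> norm (c - x) < \<delta> \<Longrightarrow>
            \<bar>d c - d x - p \<bullet> (c - x)\<bar> \<le> e / D * norm (c - x)"
          using diff[of "e / D"] by blast
        define s where "s = min 1 (\<delta> / (2 * D))"
        have s: "0 < s" "s \<le> 1" "s * D < \<delta>"
          using \<delta>(1) D by (auto simp: s_def min_def field_simps)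
        have "\<bar>(1 - s) * D - D - s * (p \<bullet> (k - x))\<bar> \<le> e / D * (s * D)"
          using \<delta>(2)[of "x + s *\<^sub>R (k - x)"] ray[of s] s dx by (simp add: D_def)
        then have "s * (p \<bullet> (k - x)) \<le> s * (- D + e)"
          using D by (simp add: algebra_simps abs_le_iff)
        then show "p \<bullet> (k - x) \<le> - D + e" using s(1) by simp
      qed
      then have "l * (q \<bullet> (k - x)) \<le> - D" by (simp add: pl)
      moreover have "q \<bullet> (k - x) \<le> D" using norm_cauchy_schwarz[of q "k - x"] q(1) by (simp add: D_def)
      \<comment> \<open>As \<open>q \<bullet> (k - x)\<close> is positive, only
        \<open>l = - 1\<close> is possible, and Cauchy-Schwarz becomes an equality.\<close>
      moreover have "l = 1 \<or> l = - 1" using l by linarith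
      ultimately have qk: "q \<bullet> (k - x) = D" using kq D by auto
      have "(k - x - D *\<^sub>R q) \<bullet> (k - x - D *\<^sub>R q) = (k - x) \<bullet> (k - x) - 2 * D * (q \<bullet> (k - x)) + D * D * (q \<bullet> q)"
        by (simp add: inner_diff_left inner_diff_right inner_commute algebra_simps)
      also have "\<dots> = 0" using q(1) qk
        by (simp add: norm_eq_1 D_def power2_norm_eq_inner[symmetric] power2_eq_square)
      finally have kx: "k - x = D *\<^sub>R q" by simp
      \<comment> \<open>By maximality \<open>z\<close> lies in the closed ball of radius
        \<open>D\<close> about \<open>k = x + D *\<^sub>R q\<close>, which meets the half space of
        the obstacle only at \<open>x\<close>.\<close>
      have "z = x" if z: "z \<in> frontier S" for z
      proof -
        have "norm (z - k) \<le> D" using norm_le_d[of z] z fr max[OF z] dx by auto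
        then have "(z - k) \<bullet> (z - k) \<le> D * D"
          by (metis norm_ge_zero power2_eq_square power2_norm_eq_inner power_mono)
        moreover have zk: "z - k = (z - x) - D *\<^sub>R q" using kx by (simp add: algebra_simps)
        have "(z - k) \<bullet> (z - k) = (z - x) \<bullet> (z - x) - 2 * D * (q \<bullet> (z - x)) + D * D * (q \<bullet> q)"
          unfolding zk by (simp add: inner_diff_left inner_diff_right inner_commute algebra_simps)
        moreover have "D * (q \<bullet> (z - x)) \<le> 0"
          using q(2)[of z] z frS D by (intro mult_nonneg_nonpos) auto
        ultimately have "(z - x) \<bullet> (z - x) \<le> 0" using q(1) by (simp add: norm_eq_1)
        then have "z - x = 0" by (metis inner_eq_zero_iff inner_ge_zero order_antisym)
        then show ?thesis by simp
      qed
      then have "frontier S \<subseteq> {x}" by blast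
      \<comment> \<open>A compact convex set is the hull of its frontier, but \<open>z0\<close> lies
        strictly below the hyperplane through \<open>x\<close>.\<close>
      then have "convex hull (frontier S) \<subseteq> {x}" by (rule hull_minimal) simp
      then have "z0 = x" using Krein_Milman_frontier[OF convex compact] z0 interior_subset by blast
      then show False using z0q by simp
    qed
  qed
  then show ?thesis using x by blast
qed

end

subsection \<open>Normals to a \<open>C\<^sup>2\<close> boundary\<close>

text \<open>Near \<open>x\<close> the set \<open>U\<close> is where the differentiable function
  \<open>\<phi>\<close> is positive, and \<open>q\<close> is the normalized negative gradient of
  \<open>\<phi>\<close> at \<open>x\<close>. Linearization gives the estimate off \<open>U\<close>.
  By convexity, a point of the closure on the wrong side of the hyperplane would yield points of the
  closure near \<open>x\<close> with negative \<open>\<phi>\<close>.\<close>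

lemma C2_boundary_normal:
  fixes U :: "'a::euclidean_space set"
  assumes U: "open U" "C2_boundary U" "convex (closure U)" and x: "x \<in> frontier U"
  shows "\<exists>q. norm q = 1 \<and> (\<forall>z\<in>closure U. q \<bullet> (z - x) \<le> 0) \<and>
    (\<forall>e>0. \<exists>\<delta>>0. \<forall>c. c \<notin> U \<longrightarrow> norm (c - x) < \<delta> \<longrightarrow> q \<bullet> (c - x) \<ge> - (e * norm (c - x)))"
proof -
  obtain r e and g :: "'a \<Rightarrow> real" where r: "r > 0" and e: "norm e = 1" and g: "C2_function g"
    and loc: "U \<inter> ball x r = {y \<in> ball x r. g (y - (y \<bullet> e) *\<^sub>R e) < y \<bullet> e}"
    using U(2) x unfolding C2_boundary_def by blast
  obtain g' :: "'a \<Rightarrow> 'a \<Rightarrow>\<^sub>L real" where g': "\<And>y. (g has_derivative blinfun_apply (g' y)) (at y)"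
    using g unfolding C2_function_def by blast
  define P where "P y = y - (y \<bullet> e) *\<^sub>R e" for y
  define \<phi> where "\<phi> y = y \<bullet> e - g (P y)" for y
  have UB: "U \<inter> ball x r = {y \<in> ball x r. \<phi> y > 0}" unfolding loc \<phi>_def P_def by auto
  define D where "D h = h \<bullet> e - g' (P x) (P h)" for h
  have der: "(\<phi> has_derivative (\<lambda>h. h \<bullet> e - g' (P y) (P h))) (at y)" for y
  proof -
    have "(P has_derivative P) (at y)"
      unfolding P_def by (auto intro!: derivative_eq_intros)
    then have "((\<lambda>y. g (P y)) has_derivative (\<lambda>h. g' (P y) (P h))) (at y)"
      by (rule has_derivative_compose[OF _ g'])
    then show ?thesis unfolding \<phi>_def by (auto intro!: derivative_eq_intros)
  qed
  then have D: "(\<phi> has_derivative D) (at x)" unfolding D_def .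
  have "continuous_on UNIV \<phi>"
    using der by (meson has_derivative_continuous continuous_at_imp_continuous_on)
  then have cl: "closed {y. \<phi> y \<ge> 0}" by (intro closed_Collect_le continuous_on_const) auto
  have "ball x r \<inter> closure U \<subseteq> closure (ball x r \<inter> U)" by (rule open_Int_closure_subset) simp
  also have "\<dots> \<subseteq> {y. \<phi> y \<ge> 0}"
    unfolding Int_commute[of _ U] UB by (intro closure_minimal cl) auto
  finally have pos: "\<phi> y \<ge> 0" if "y \<in> ball x r" "y \<in> closure U" for y using that by blast
  have neg: "\<phi> y \<le> 0" if "y \<in> ball x r" "y \<notin> U" for y using UB that by force
  have "x \<in> closure U" "x \<notin> U" using x U(1) by (auto simp: frontier_def interior_open)
  then have \<phi>x: "\<phi> x = 0" using pos[of x] neg[of x] r by auto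
  have linD: "linear D" using D by (rule has_derivative_linear)
  define n where "n = adjoint D 1"
  have n: "n \<bullet> h = D h" for h
    using adjoint_works[OF linD, of h 1] by (simp add: n_def inner_commute)
  \<comment> \<open>\<open>P\<close> annihilates \<open>e\<close>, so \<open>\<phi>\<close> has
    slope 1 along \<open>e\<close> and its gradient \<open>n\<close> does not vanish.\<close>
  have "P e = 0" using e by (simp add: P_def norm_eq_1)
  then have "n \<bullet> e = 1" using e by (simp add: n D_def norm_eq_1)
  then have n0: "n \<noteq> 0" by auto
  have lin: "\<exists>\<delta>>0. \<forall>y. norm (y - x) < \<delta> \<longrightarrow> y \<in> ball x r \<and> \<bar>\<phi> y - n \<bullet> (y - x)\<bar> \<le> \<epsilon> * norm (y - x)"
    if "\<epsilon> > 0" for \<epsilon>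
  proof -
    obtain \<delta> where "\<delta> > 0" "\<And>y. norm (y - x) < \<delta> \<Longrightarrow> norm (\<phi> y - \<phi> x - D (y - x)) \<le> \<epsilon> * norm (y - x)"
      using D \<open>\<epsilon> > 0\<close> unfolding has_derivative_at_alt by meson
    then show ?thesis
      using r \<phi>x n by (intro exI[of _ "min \<delta> r"]) (auto simp: dist_norm norm_minus_commute)
  qed
  have supp: "n \<bullet> (z - x) \<ge> 0" if z: "z \<in> closure U" for z
  proof (rule ccontr)
    assume "\<not> ?thesis"
    define a where "a = - (n \<bullet> (z - x))"
    define m where "m = norm (z - x)"
    have a: "a > 0" and m: "m > 0" using \<open>\<not> n \<bullet> (z - x) \<ge> 0\<close> by (auto simp: a_def m_def)
    \<comment> \<open>With this tolerance the error at distance \<open>t * m\<close> is half of the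
      linear decrease \<open>t * a\<close>.\<close>
    obtain \<delta> where \<delta>: "\<delta> > 0" "\<And>y. norm (y - x) < \<delta> \<Longrightarrow>
        y \<in> ball x r \<and> \<bar>\<phi> y - n \<bullet> (y - x)\<bar> \<le> a / (2 * m) * norm (y - x)"
      using lin[of "a / (2 * m)"] a m by auto
    define t where "t = min 1 (\<delta> / (2 * m))"
    have t: "0 < t" "t \<le> 1" "t * m < \<delta>"
      using \<delta>(1) m by (auto simp: t_def min_def field_simps)
    define y where "y = x + t *\<^sub>R (z - x)"
    have yx: "norm (y - x) = t * m" "n \<bullet> (y - x) = - (t * a)"
      using t by (simp_all add: y_def m_def a_def)
    have "y = (1 - t) *\<^sub>R x + t *\<^sub>R z" by (simp add: y_def algebra_simps)
    then have "y \<in> closure U"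
      using convexD_alt[OF U(3) \<open>x \<in> closure U\<close> z, of t] t by simp
    moreover have "y \<in> ball x r" "\<bar>\<phi> y + t * a\<bar> \<le> a / (2 * m) * (t * m)"
      using \<delta>(2)[of y] yx t by auto
    moreover have "a / (2 * m) * (t * m) = t * a / 2" using m by simp
    moreover have "t * a > 0" using t a by simp
    ultimately show False using pos[of y] by linarith
  qed
  define q where "q = - (1 / norm n) *\<^sub>R n"
  have qh: "q \<bullet> h = - (n \<bullet> h) / norm n" for h by (simp add: q_def)
  have "norm q = 1" using n0 by (simp add: q_def)
  moreover have "q \<bullet> (z - x) \<le> 0" if "z \<in> closure U" for z
    using supp[OF that] by (simp add: qh)
  moreover have "\<exists>\<delta>>0. \<forall>c. c \<notin> U \<longrightarrow> norm (c - x) < \<delta> \<longrightarrow> q \<bullet> (c - x) \<ge> - (\<epsilon> * norm (c - x))"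
    if \<epsilon>: "\<epsilon> > 0" for \<epsilon>
  proof -
    obtain \<delta> where \<delta>: "\<delta> > 0" "\<And>y. norm (y - x) < \<delta> \<Longrightarrow>
        y \<in> ball x r \<and> \<bar>\<phi> y - n \<bullet> (y - x)\<bar> \<le> \<epsilon> * norm n * norm (y - x)"
      using lin[of "\<epsilon> * norm n"] \<epsilon> n0 by auto
    have "q \<bullet> (c - x) \<ge> - (\<epsilon> * norm (c - x))" if c: "c \<notin> U" "norm (c - x) < \<delta>" for c
    proof -
      have "n \<bullet> (c - x) \<le> \<epsilon> * norm n * norm (c - x)"
        using \<delta>(2)[OF c(2)] neg[OF _ c(1)] by fastforce
      then show ?thesis using n0 by (simp add: qh field_simps)
    qed
    then show ?thesis using \<delta>(1) by blast
  qed
  ultimately show ?thesis by blast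
qed

section \<open>Application to the closure of an open set with smooth boundary\<close>

theorem theorem6:
  fixes U \<O> :: "(real ^ 'n) set" and k\<^sub>0 :: "real ^ 'n"
  assumes "open U" and "U \<noteq> {}" and "bounded U" and "connected U"
    and "C2_boundary U"
    and "\<O> = closure U"
    and "convex \<O>"
    and "connected (- \<O>)"
    and "k\<^sub>0 \<in> - \<O>"
  shows "frontier \<O> \<inter> singular_set \<O> k\<^sub>0 \<noteq> {}"
proof -
  have UO: "U \<subseteq> interior \<O>" unfolding assms(6) by (intro interior_maximal closure_subset assms(1))
  then obtain z0 where z0: "z0 \<in> interior \<O>" using assms(2) by blast
  interpret convex_obstacle \<O> k\<^sub>0 z0
    using assms z0 by unfold_locales (simp_all add: compact_closure)
  show ?thesis
  proof (rule frontier_meets_singular_set)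
    fix x assume "x \<in> frontier \<O>"
    \<comment> \<open>Taking the closure creates no new boundary points: \<open>U\<close> lies in
      the interior of its closure.\<close>
    then have "x \<in> frontier U" using UO assms(1,6) by (auto simp: frontier_def interior_open)
    then obtain q where q: "norm q = 1" "\<forall>z\<in>closure U. q \<bullet> (z - x) \<le> 0"
      "\<forall>e>0. \<exists>\<delta>>0. \<forall>c. c \<notin> U \<longrightarrow> norm (c - x) < \<delta> \<longrightarrow> q \<bullet> (c - x) \<ge> - (e * norm (c - x))"
      using C2_boundary_normal assms(1,5,6,7) by metis
    moreover have "c \<notin> U" if "c \<in> closure (- \<O>)" for c
      using that UO by (auto simp: closure_complement)
    ultimately show "\<exists>q. norm q = 1 \<and> (\<forall>z\<in>\<O>. q \<bullet> (z - x) \<le> 0) \<and>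
      (\<forall>e>0. \<exists>\<delta>>0. \<forall>c\<in>closure (- \<O>). norm (c - x) < \<delta> \<longrightarrow> q \<bullet> (c - x) \<ge> - (e * norm (c - x)))"
      using assms(6) by metis
  qed
qed

end
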